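(* For fixed integers $t\ge 2$, $p\ge 2$ and $q\ge 1$, \[ rsat(n,F_{t,p,q})=(p+q-1)n+O(1) \] for sufficiently large $n$; that is, $|rsat(n,F_{t,p,q})-(p+q-1)n|$ is bounded by a constant depending only on $t,p,q$ for all sufficiently large $n$.
   Context: All graphs are finite, simple and undirected. $|G|$ and $e(G)$ denote the number of vertices and edges of $G$; $tG$ is the vertex-disjoint union of $t$ copies of $G$; $G_1\vee G_2$ is the join (disjoint union plus all edges between $G_1$ and $G_2$). The generalized friendship graph is $F_{t,p,q}=tK_p\vee K_q=(tK_p)\vee K_q$. An edge-colored graph is a pair $(G,\mathcal C)$ with $\mathcal C:E(G)\to\mathbb N$ an arbitrary map (not necessarily a proper coloring). A subgraph is rainbow if its edges have pairwise distinct colors. For a nonedge $e$ of $G$ and $\alpha\in\mathbb N$, $(G,\mathcal C)+_\alpha e$ is the edge-colored graph obtained by adding $e$ with color $\alpha$. $(G,\mathcal C)$ is $F$-rainbow saturated if it contains no rainbow copy of $F$ (a copy is a not necessarily induced subgraph isomorphic to $F$) and, for every nonedge $e$ and every $\alpha\in\mathbb N$, $(G,\mathcal C)+_\alpha e$ contains a rainbow copy of $F$ containing $e$. $rsat(n,F)$ is the minimum of $e(G)$ over all graphs $G$ with $|G|=n$ such that $(G,\mathcal C)$ is $F$-rainbow saturated for some $\mathcal C$. *)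

theory Defs
  imports Complex_Main
begin

section \<open>Finite simple graphs\<close>

text \<open>Edges are two-element sets of vertices, so each undirected edge is counted once.\<close>

datatype 'a graph = Graph (verts: "'a set") (edges: "'a set set")

definition all_pairs :: "'a set \<Rightarrow> 'a set set" where
  "all_pairs V = {e. e \<subseteq> V \<and> card e = 2}"

definition simple_graph :: "'a graph \<Rightarrow> bool" where
  "simple_graph G \<longleftrightarrow> finite (verts G) \<and> edges G \<subseteq> all_pairs (verts G)"

definition nonedges :: "'a graph \<Rightarrow> 'a set set" where
  "nonedges G = all_pairs (verts G) - edges G"

definition add_edge :: "'a graph \<Rightarrow> 'a set \<Rightarrow> 'a graph" where
  "add_edge G e = Graph (verts G) (insert e (edges G))"

definition subgraph :: "'a graph \<Rightarrow> 'a graph \<Rightarrow> bool" where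
  "subgraph H G \<longleftrightarrow> simple_graph H \<and> verts H \<subseteq> verts G \<and> edges H \<subseteq> edges G"

definition isomorphic :: "'a graph \<Rightarrow> 'b graph \<Rightarrow> bool" where
  "isomorphic G H \<longleftrightarrow> (\<exists>f. bij_betw f (verts G) (verts H) \<and>
     (\<forall>u\<in>verts G. \<forall>v\<in>verts G. {u, v} \<in> edges G \<longleftrightarrow> {f u, f v} \<in> edges H))"

section \<open>Generalized friendship graphs\<close>

definition complete_graph :: "nat \<Rightarrow> nat graph" where
  "complete_graph n = Graph {..<n} (all_pairs {..<n})"

definition disjoint_copies :: "nat \<Rightarrow> 'a graph \<Rightarrow> (nat \<times> 'a) graph" where
  "disjoint_copies t G =
     Graph ({..<t} \<times> verts G) {Pair i ` e | i e. i < t \<and> e \<in> edges G}"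

definition graph_join :: "'a graph \<Rightarrow> 'b graph \<Rightarrow> ('a + 'b) graph" where
  "graph_join G\<^sub>1 G\<^sub>2 =
     Graph (verts G\<^sub>1 <+> verts G\<^sub>2)
       ({Inl ` e | e. e \<in> edges G\<^sub>1} \<union> {Inr ` e | e. e \<in> edges G\<^sub>2} \<union>
        {{Inl u, Inr v} | u v. u \<in> verts G\<^sub>1 \<and> v \<in> verts G\<^sub>2})"

definition friendship_graph :: "nat \<Rightarrow> nat \<Rightarrow> nat \<Rightarrow> (nat \<times> nat + nat) graph" where
  "friendship_graph t p q =
     graph_join (disjoint_copies t (complete_graph p)) (complete_graph q)"

section \<open>Rainbow saturation\<close>

text \<open>A coloring is a total function on sets of vertices; below, only its values on the
  edges of the graph at hand matter.\<close>

type_synonym 'a coloring = "'a set \<Rightarrow> nat"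

definition rainbow :: "'a coloring \<Rightarrow> 'a graph \<Rightarrow> bool" where
  "rainbow c H \<longleftrightarrow> inj_on c (edges H)"

definition rainbow_copy :: "'b graph \<Rightarrow> 'a graph \<Rightarrow> 'a coloring \<Rightarrow> 'a graph \<Rightarrow> bool" where
  "rainbow_copy F G c H \<longleftrightarrow> subgraph H G \<and> isomorphic H F \<and> rainbow c H"

definition rainbow_saturated :: "'b graph \<Rightarrow> 'a graph \<Rightarrow> 'a coloring \<Rightarrow> bool" where
  "rainbow_saturated F G c \<longleftrightarrow>
     (\<nexists>H. rainbow_copy F G c H) \<and>
     (\<forall>e\<in>nonedges G. \<forall>\<alpha>. \<exists>H. rainbow_copy F (add_edge G e) (c(e := \<alpha>)) H \<and> e \<in> edges H)"

text \<open>Every finite graph is isomorphic to one with vertices in \<^typ>\<open>nat\<close>, so it suffices to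
  minimize over those. The set of edge counts is a set of naturals, so its infimum is its
  minimum if it is nonempty, and \<open>0\<close> otherwise. Hence a positive value of \<open>rsat n F\<close> entails
  that a saturated graph exists.\<close>

definition rsat :: "nat \<Rightarrow> 'b graph \<Rightarrow> nat" where
  "rsat n F = Inf {card (edges G) | G :: nat graph.
     simple_graph G \<and> card (verts G) = n \<and> (\<exists>c. rainbow_saturated F G c)}"

end

theory Submission
  imports Defs "HOL-Library.Nat_Bijection" "HOL-Library.FuncSet"
begin

text \<open>A copy of the friendship graph consists of \<open>t\<close> cliques of size \<open>p + q\<close> meeting in a set \<open>Q\<close>. Adding
  a nonedge \<open>uv\<close> with a color already used at \<open>u\<close> shows that nonadjacent vertices of a saturated
  graph have \<open>s = p + q - 1\<close> common neighbours; counting edges at a vertex of small degree gives the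
  lower bound.

  For the upper bound take a set \<open>S\<close> of \<open>s\<close> vertices joined to everything, boundedly many blocks
  \<open>K\<^sub>p\<close>, and otherwise isolated vertices. A rainbow copy inside \<open>S\<close> and the blocks is excluded since
  too few colors occur there. A copy that uses another vertex \<open>u\<close> contains \<open>S \<union> {u}\<close>, hence all
  colors inside \<open>S\<close>, so it cannot use the blocks which repeat such a color; reserving some colors
  for these blocks leaves too few colors again. A new edge \<open>ux\<close> closes a clique with \<open>S\<close> minus one
  vertex, which frees a color of \<open>S\<close>. As every admissible block coloring occurs often enough, the
  clique extends to a rainbow copy. The nonedges among the boundedly many vertices of \<open>S\<close> and the
  blocks only cost \<open>O(1)\<close> further edges.\<close>

subsection \<open>Windmills and copies of friendship graphs\<close>

lemma pair_in_all_pairs [simp]: "{u, v} \<in> all_pairs V \<longleftrightarrow> u \<in> V \<and> v \<in> V \<and> u \<noteq> v"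
  by (auto simp: all_pairs_def card_insert_if)

lemma all_pairsE:
  assumes "e \<in> all_pairs V"
  obtains u v where "e = {u, v}" "u \<in> V" "v \<in> V" "u \<noteq> v"
  using assms by (auto simp: all_pairs_def card_2_iff)

lemma finite_all_pairs [simp]: "finite V \<Longrightarrow> finite (all_pairs V)"
  by (simp add: all_pairs_def)

lemma card_all_pairs: "finite V \<Longrightarrow> card (all_pairs V) = card V choose 2"
  by (simp add: all_pairs_def n_subsets)

lemma all_pairs_mono: "V \<subseteq> W \<Longrightarrow> all_pairs V \<subseteq> all_pairs W"
  by (auto simp: all_pairs_def)

lemma all_pairs_Int: "all_pairs V \<inter> all_pairs W = all_pairs (V \<inter> W)"
  by (auto simp: all_pairs_def)

lemma all_pairs_image:
  assumes "inj_on f V"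
  shows "all_pairs (f ` V) = (image f) ` all_pairs V"
proof
  show "all_pairs (f ` V) \<subseteq> (image f) ` all_pairs V"
  proof
    fix e assume "e \<in> all_pairs (f ` V)"
    then obtain u v where "e = f ` {u, v}" "{u, v} \<in> all_pairs V"
      by (elim all_pairsE) auto
    then show "e \<in> (image f) ` all_pairs V"
      by blast
  qed
  show "(image f) ` all_pairs V \<subseteq> all_pairs (f ` V)"
    using assms by (auto elim!: all_pairsE dest: inj_onD)
qed

text \<open>Edge set of a copy with kernel \<open>Q\<close> and petals \<open>P i\<close>. It
  describes a copy completely, so isomorphisms occur only up to \<open>rainbow_copyE\<close> and
  \<open>rainbow_copyI\<close>.\<close>

definition windmill :: "nat \<Rightarrow> 'a set \<Rightarrow> (nat \<Rightarrow> 'a set) \<Rightarrow> 'a set set" where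
  "windmill t Q P = (\<Union>i<t. all_pairs (Q \<union> P i))"

definition petals :: "nat \<Rightarrow> nat \<Rightarrow> nat \<Rightarrow> 'a set \<Rightarrow> (nat \<Rightarrow> 'a set) \<Rightarrow> bool" where
  "petals t p q Q P \<longleftrightarrow> finite Q \<and> card Q = q \<and>
     (\<forall>i<t. finite (P i) \<and> card (P i) = p \<and> Q \<inter> P i = {}) \<and>
     (\<forall>i<t. \<forall>j<t. i \<noteq> j \<longrightarrow> P i \<inter> P j = {})"

lemma petals_Int:
  "petals t p q Q P \<Longrightarrow> i < t \<Longrightarrow> j < t \<Longrightarrow> i \<noteq> j \<Longrightarrow> (Q \<union> P i) \<inter> (Q \<union> P j) = Q"
  unfolding petals_def by blast

lemma petals_card: "petals t p q Q P \<Longrightarrow> i < t \<Longrightarrow> finite (Q \<union> P i) \<and> card (Q \<union> P i) = p + q"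
  by (simp add: petals_def card_Un_disjoint)

lemma card_new_pairs:
  assumes "finite Q" "finite D" "Q \<inter> D = {}"
  shows "card (all_pairs (Q \<union> D) - all_pairs Q) =
    ((card D + card Q) choose 2) - (card Q choose 2)"
proof -
  have "card (all_pairs (Q \<union> D) - all_pairs Q) = card (all_pairs (Q \<union> D)) - card (all_pairs Q)"
    using assms by (intro card_Diff_subset) (auto simp: all_pairs_def)
  then show ?thesis
    using assms by (simp add: card_all_pairs card_Un_disjoint add.commute)
qed

text \<open>Two of the cliques meet exactly in \<open>Q\<close>, so the pairs that they add to those
  inside \<open>Q\<close> form disjoint families, while the pairs inside \<open>Q\<close> count
  once.\<close>

lemma card_windmill:
  assumes "petals t p q Q P" "t \<ge> 1"
  shows "card (windmill t Q P) = (q choose 2) + t * (((p + q) choose 2) - (q choose 2))"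
proof -
  let ?N = "\<lambda>i. all_pairs (Q \<union> P i) - all_pairs Q"
  have fin: "finite Q" "\<And>i. i < t \<Longrightarrow> finite (P i)"
    using assms by (auto simp: petals_def)
  have eq: "windmill t Q P = all_pairs Q \<union> (\<Union>i<t. ?N i)"
    using assms(2) all_pairs_mono[of Q "Q \<union> P 0"] by (fastforce simp: windmill_def)
  have disj: "?N i \<inter> ?N j = {}" if "i < t" "j < t" "i \<noteq> j" for i j
    using all_pairs_Int[of "Q \<union> P i" "Q \<union> P j"] petals_Int[OF assms(1) that] by auto
  have "card (\<Union>i<t. ?N i) = (\<Sum>i<t. card (?N i))"
    using fin disj by (intro card_UN_disjoint) auto
  also have "\<dots> = (\<Sum>i<t. ((p + q) choose 2) - (q choose 2))"
    using assms(1) by (intro sum.cong refl) (subst card_new_pairs, auto simp: petals_def)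
  finally have "card (\<Union>i<t. ?N i) = t * (((p + q) choose 2) - (q choose 2))"
    by simp
  moreover have "card (windmill t Q P) = card (all_pairs Q) + card (\<Union>i<t. ?N i)"
    unfolding eq using fin by (intro card_Un_disjoint) auto
  ultimately show ?thesis
    using assms(1) by (simp add: card_all_pairs petals_def)
qed

section \<open>Translation between copies up to isomorphism and windmills\<close>

lemma isomorphic_edges_image:
  assumes "isomorphic H F" "edges H \<subseteq> all_pairs (verts H)" "edges F \<subseteq> all_pairs (verts F)"
  obtains g where "bij_betw g (verts F) (verts H)" "edges H = (image g) ` edges F"
proof -
  obtain f where f: "bij_betw f (verts H) (verts F)"
    and fe: "\<And>u v. u \<in> verts H \<Longrightarrow> v \<in> verts H \<Longrightarrow> {u, v} \<in> edges H \<longleftrightarrow> {f u, f v} \<in> edges F"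
    using assms(1) unfolding isomorphic_def by blast
  define g where "g = inv_into (verts H) f"
  have g: "bij_betw g (verts F) (verts H)"
    unfolding g_def by (rule bij_betw_inv_into[OF f])
  have gf: "g (f v) = v" if "v \<in> verts H" for v
    unfolding g_def using f that by (simp add: bij_betw_def)
  have fg: "f (g v) = v" if "v \<in> verts F" for v
    unfolding g_def using f that by (simp add: bij_betw_def f_inv_into_f)
  have gV: "g v \<in> verts H" if "v \<in> verts F" for v
    using g that by (auto simp: bij_betw_def)
  have "edges H = (image g) ` edges F"
  proof (intro equalityI subsetI)
    fix e assume e: "e \<in> edges H"
    then obtain u v where uv: "e = {u, v}" "u \<in> verts H" "v \<in> verts H"
      using assms(2) by (blast elim: all_pairsE)
    then have "{f u, f v} \<in> edges F" "e = g ` {f u, f v}"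
      using fe e by (auto simp: gf)
    then show "e \<in> (image g) ` edges F" by blast
  next
    fix e assume "e \<in> (image g) ` edges F"
    then obtain a where a: "a \<in> edges F" "e = g ` a" by blast
    then obtain u v where uv: "a = {u, v}" "u \<in> verts F" "v \<in> verts F"
      using assms(3) by (blast elim: all_pairsE)
    then show "e \<in> edges H"
      using a fe[of "g u" "g v"] by (simp add: fg gV)
  qed
  with g that show thesis by blast
qed

lemma isomorphic_if_edges_image:
  assumes "bij_betw g (verts F) (verts H)" "edges H = (image g) ` edges F"
    and "edges F \<subseteq> all_pairs (verts F)"
  shows "isomorphic H F"
proof -
  define f where "f = inv_into (verts F) g"
  have f: "bij_betw f (verts H) (verts F)"
    unfolding f_def by (rule bij_betw_inv_into[OF assms(1)])
  have inj: "inj_on g (verts F)" using assms(1) by (simp add: bij_betw_def)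
  have gf: "g (f v) = v" "f v \<in> verts F" if "v \<in> verts H" for v
    using assms(1) f that by (auto simp: f_def bij_betw_def f_inv_into_f)
  have "{u, v} \<in> edges H \<longleftrightarrow> {f u, f v} \<in> edges F" if uv: "u \<in> verts H" "v \<in> verts H" for u v
  proof
    assume "{u, v} \<in> edges H"
    then obtain a where a: "a \<in> edges F" "g ` a = g ` {f u, f v}"
      using assms(2) gf uv by auto
    have "a \<subseteq> verts F" using a assms(3) by (auto simp: all_pairs_def)
    then have "a = {f u, f v}"
      using a(2) gf uv inj by (meson inj_on_image_eq_iff empty_subsetI insert_subset)
    then show "{f u, f v} \<in> edges F" using a by simp
  next
    assume "{f u, f v} \<in> edges F"
    then have "g ` {f u, f v} \<in> edges H" using assms(2) by blast
    then show "{u, v} \<in> edges H" using gf uv by simp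
  qed
  then show ?thesis unfolding isomorphic_def using f by blast
qed

definition standard_petal :: "nat \<Rightarrow> nat \<Rightarrow> (nat \<times> nat + nat) set" where
  "standard_petal p i = (\<lambda>x. Inl (i, x)) ` {..<p}"

lemma verts_friendship_graph:
  "verts (friendship_graph t p q) = Inr ` {..<q} \<union> (\<Union>i<t. standard_petal p i)"
  by (auto simp: friendship_graph_def graph_join_def disjoint_copies_def complete_graph_def
      standard_petal_def)

lemma edges_friendship_graph:
  assumes "t \<ge> 1"
  shows "edges (friendship_graph t p q) = windmill t (Inr ` {..<q}) (standard_petal p)"
proof -
  have img: "Inl ` Pair i ` e \<in> all_pairs (Inr ` {..<q} \<union> standard_petal p i)"
    if "e \<in> all_pairs {..<p}" for e i
    using that by (auto simp: standard_petal_def elim!: all_pairsE)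
  have img': "Inr ` e \<in> all_pairs (Inr ` {..<q} \<union> standard_petal p i)"
    if "e \<in> all_pairs {..<q}" for e i
    using that by (auto elim!: all_pairsE)
  show ?thesis
  proof (intro equalityI subsetI)
    fix e assume "e \<in> edges (friendship_graph t p q)"
    then consider (a) a i where "i < t" "a \<in> all_pairs {..<p}" "e = Inl ` Pair i ` a"
      | (b) a where "a \<in> all_pairs {..<q}" "e = Inr ` a"
      | (c) i x y where "i < t" "x < p" "y < q" "e = {Inl (i, x), Inr y}"
      by (auto simp: friendship_graph_def graph_join_def disjoint_copies_def complete_graph_def)
    then show "e \<in> windmill t (Inr ` {..<q}) (standard_petal p)"
    proof cases
      case a then show ?thesis using img by (auto simp: windmill_def)
    next
      case b then show ?thesis using img' assms by (fastforce simp: windmill_def)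
    next
      case c then show ?thesis by (auto simp: windmill_def standard_petal_def)
    qed
  next
    fix e assume "e \<in> windmill t (Inr ` {..<q}) (standard_petal p)"
    then obtain i u v where i: "i < t" "e = {u, v}" "u \<noteq> v"
      "u \<in> Inr ` {..<q} \<union> standard_petal p i" "v \<in> Inr ` {..<q} \<union> standard_petal p i"
      by (auto simp: windmill_def elim!: all_pairsE)
    have a: "{Inl (i, x), Inl (i, y)} \<in> edges (friendship_graph t p q)"
      if "x < p" "y < p" "x \<noteq> y" for x y
    proof -
      have "{Inl (i, x), Inl (i, y)} = Inl ` Pair i ` {x, y}" by simp
      moreover have "{x, y} \<in> all_pairs {..<p}" using that by simp
      ultimately show ?thesis using i(1)
        unfolding friendship_graph_def graph_join_def disjoint_copies_def complete_graph_def
          graph.sel by blast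
    qed
    have b: "{Inr x, Inr y} \<in> edges (friendship_graph t p q)"
      if "x < q" "y < q" "x \<noteq> y" for x y
    proof -
      have "{Inr x, Inr y} = Inr ` {x, y}" by simp
      moreover have "{x, y} \<in> all_pairs {..<q}" using that by simp
      ultimately show ?thesis
        unfolding friendship_graph_def graph_join_def disjoint_copies_def complete_graph_def
          graph.sel by blast
    qed
    have c: "{Inl (i, x), Inr y} \<in> edges (friendship_graph t p q)" if "x < p" "y < q" for x y
      using i(1) that
      by (auto simp: friendship_graph_def graph_join_def disjoint_copies_def complete_graph_def)
    have c': "{Inr y, Inl (i, x)} \<in> edges (friendship_graph t p q)" if "x < p" "y < q" for x y
      using c[OF that] by (simp add: insert_commute)
    show "e \<in> edges (friendship_graph t p q)"
      using i a b c c' by (auto simp: standard_petal_def)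
  qed
qed

lemma petals_standard: "petals t p q (Inr ` {..<q}) (standard_petal p)"
  by (auto simp: petals_def standard_petal_def card_image inj_on_def)

lemma windmill_subset_all_pairs: "windmill t Q P \<subseteq> all_pairs (Q \<union> (\<Union>i<t. P i))"
  unfolding windmill_def by (intro UN_least all_pairs_mono) auto

lemma edges_friendship_graph_subset:
  "t \<ge> 1 \<Longrightarrow> edges (friendship_graph t p q) \<subseteq> all_pairs (verts (friendship_graph t p q))"
  using windmill_subset_all_pairs by (simp add: edges_friendship_graph verts_friendship_graph)

lemma windmill_image:
  assumes "inj_on g (Q \<union> (\<Union>i<t. P i))"
  shows "(image g) ` windmill t Q P = windmill t (g ` Q) (\<lambda>i. g ` P i)"
proof -
  have "(image g) ` all_pairs (Q \<union> P i) = all_pairs (g ` Q \<union> g ` P i)" if "i < t" for i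
    using all_pairs_image[of g "Q \<union> P i"] inj_on_subset[OF assms, of "Q \<union> P i"] that
    by (auto simp: image_Un)
  then show ?thesis by (simp add: windmill_def image_UN)
qed

lemma petals_image:
  assumes "inj_on g (Q \<union> (\<Union>i<t. P i))" "petals t p q Q P"
  shows "petals t p q (g ` Q) (\<lambda>i. g ` P i)"
proof -
  have inj: "inj_on g Q" "\<And>i. i < t \<Longrightarrow> inj_on g (P i)"
    by (auto intro: inj_on_subset[OF assms(1)])
  have "g ` A \<inter> g ` B = {}"
    if "A \<inter> B = {}" "A \<subseteq> Q \<union> (\<Union>i<t. P i)" "B \<subseteq> Q \<union> (\<Union>i<t. P i)" for A B
    using inj_on_image_Int[OF assms(1) that(2,3)] that(1) by simp
  moreover have "P i \<subseteq> Q \<union> (\<Union>i<t. P i)" if "i < t" for i using that by auto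
  ultimately show ?thesis
    using assms(2) inj unfolding petals_def by (simp add: card_image)
qed

text \<open>The isomorphism is injective on the vertices, so it carries the standard kernel and
  petals to sets of the same sizes that are still disjoint.\<close>

lemma rainbow_copyE:
  assumes "rainbow_copy (friendship_graph t p q) G c H" "t \<ge> 1"
  obtains Q P where "petals t p q Q P" "edges H = windmill t Q P" "Q \<union> (\<Union>i<t. P i) \<subseteq> verts G"
    "windmill t Q P \<subseteq> edges G" "inj_on c (windmill t Q P)"
proof -
  let ?F = "friendship_graph t p q"
  have H: "isomorphic H ?F" "edges H \<subseteq> all_pairs (verts H)" "verts H \<subseteq> verts G"
    "edges H \<subseteq> edges G" "inj_on c (edges H)"
    using assms(1) by (auto simp: rainbow_copy_def subgraph_def simple_graph_def rainbow_def)
  obtain g where g: "bij_betw g (verts ?F) (verts H)" "edges H = (image g) ` edges ?F"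
    using isomorphic_edges_image[OF H(1,2) edges_friendship_graph_subset[OF assms(2)]] .
  define Q P where "Q = g ` Inr ` {..<q}" and "P = (\<lambda>i. g ` standard_petal p i)"
  have inj: "inj_on g (Inr ` {..<q} \<union> (\<Union>i<t. standard_petal p i))"
    and V: "Q \<union> (\<Union>i<t. P i) = verts H"
    using g(1) by (simp_all add: verts_friendship_graph bij_betw_def image_Un image_UN Q_def P_def)
  have "petals t p q Q P"
    unfolding Q_def P_def by (rule petals_image[OF inj petals_standard])
  moreover have "edges H = windmill t Q P"
    unfolding Q_def P_def g(2) edges_friendship_graph[OF assms(2)] by (rule windmill_image[OF inj])
  moreover have "Q \<union> (\<Union>i<t. P i) \<subseteq> verts G"
    unfolding V by (rule H(3))
  ultimately show thesis using that H(4,5) by metis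
qed

text \<open>Enumerations of \<open>Q\<close> and of the petals glue to one bijection, because these
  sets are pairwise disjoint.\<close>

lemma rainbow_copyI:
  fixes Q :: "'a set"
  assumes "petals t p q Q P" "t \<ge> 1" "Q \<union> (\<Union>i<t. P i) \<subseteq> verts G"
    "windmill t Q P \<subseteq> edges G" "inj_on c (windmill t Q P)"
  obtains H where "rainbow_copy (friendship_graph t p q) G c H" "edges H = windmill t Q P"
proof -
  let ?F = "friendship_graph t p q"
  let ?V = "Q \<union> (\<Union>i<t. P i)"
  have fin: "finite Q" "\<And>i. i < t \<Longrightarrow> finite (P i)"
    using assms(1) by (auto simp: petals_def)
  obtain h0 where h0: "bij_betw h0 {..<q} Q"
    using ex_bij_betw_nat_finite[of Q] assms(1) by (auto simp: petals_def lessThan_atLeast0)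
  have "\<exists>h. bij_betw h {..<p} (P i)" if "i < t" for i
    using ex_bij_betw_nat_finite[of "P i"] assms(1) that
    by (auto simp: petals_def lessThan_atLeast0)
  then obtain h where h: "\<And>i. i < t \<Longrightarrow> bij_betw (h i) {..<p} (P i)" by metis
  define g :: "nat \<times> nat + nat \<Rightarrow> 'a" where "g = case_sum (\<lambda>(i, x). h i x) h0"
  have gQ: "g ` Inr ` {..<q} = Q"
    using h0 by (simp add: g_def image_image bij_betw_def)
  have gP: "g ` standard_petal p i = P i" if "i < t" for i
    using h[OF that] by (simp add: g_def standard_petal_def image_image bij_betw_def)
  have img: "g ` verts ?F = ?V"
    by (simp add: verts_friendship_graph image_Un image_UN gQ gP)
  have "g a \<noteq> g b" if "a \<in> verts ?F" "b \<in> verts ?F" "a \<noteq> b" for a b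
  proof -
    have ne: "h0 x \<noteq> h i y" if "x < q" "y < p" "i < t" for x i y
      using bij_betwE[OF h0] bij_betwE[OF h[OF that(3)]] that assms(1)
      unfolding petals_def by (metis IntI empty_iff lessThan_iff)
    have ne': "h j x \<noteq> h i y" if "x < p" "y < p" "i < t" "j < t" "i \<noteq> j" for x i y j
      using bij_betwE[OF h[OF that(4)]] bij_betwE[OF h[OF that(3)]] that assms(1)
      unfolding petals_def by (metis IntI empty_iff lessThan_iff)
    have "x = y" if "h0 x = h0 y" "x < q" "y < q" for x y
      using h0 that by (auto simp: bij_betw_def inj_on_def)
    moreover have "x = y" if "h i x = h i y" "x < p" "y < p" "i < t" for x y i
      using h[OF that(4)] that by (auto simp: bij_betw_def inj_on_def)
    ultimately show ?thesis
      using that ne ne' ne[symmetric]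
      by (auto simp: verts_friendship_graph standard_petal_def g_def) blast+
  qed
  then have inj: "inj_on g (verts ?F)" by (auto simp: inj_on_def)
  have inj': "inj_on g (Inr ` {..<q} \<union> (\<Union>i<t. standard_petal p i))"
    using inj by (simp add: verts_friendship_graph)
  have eimg: "windmill t Q P = (image g) ` edges ?F"
    unfolding edges_friendship_graph[OF assms(2)] windmill_image[OF inj']
    by (simp add: windmill_def gQ gP)
  define H where "H = Graph ?V (windmill t Q P)"
  have "isomorphic H ?F"
    by (rule isomorphic_if_edges_image[of g])
      (use inj img eimg edges_friendship_graph_subset[OF assms(2)]
        in \<open>auto simp: H_def bij_betw_def\<close>)
  moreover have "subgraph H G"
    using fin assms(3,4) windmill_subset_all_pairs[of t Q P]
    by (auto simp: subgraph_def simple_graph_def H_def)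
  ultimately have "rainbow_copy ?F G c H"
    using assms(5) by (simp add: rainbow_copy_def rainbow_def H_def)
  then show thesis using that by (simp add: H_def)
qed

subsection \<open>Lower bound\<close>

text \<open>The new edge lies in one clique \<open>Q \<union> P i\<close> of the copy. The other
  vertices of this clique are common neighbours of its ends, and rainbowness keeps the color
  \<alpha> of the new edge off all other edges of the clique.\<close>

lemma saturated_common_neighbours_avoiding:
  assumes "rainbow_saturated (friendship_graph t p q) G c" "t \<ge> 1"
    and "u \<in> verts G" "v \<in> verts G" "u \<noteq> v" "{u, v} \<notin> edges G"
  obtains W where "finite W" "card W = p + q - 2"
    "\<And>w. w \<in> W \<Longrightarrow> {u, w} \<in> edges G \<and> {v, w} \<in> edges G \<and> c {u, w} \<noteq> \<alpha>"
proof -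
  let ?c = "c({u, v} := \<alpha>)"
  have "{u, v} \<in> nonedges G" using assms by (simp add: nonedges_def)
  then obtain H where H: "rainbow_copy (friendship_graph t p q) (add_edge G {u, v}) ?c H"
    "{u, v} \<in> edges H"
    using assms(1) unfolding rainbow_saturated_def by blast
  obtain Q P where QP: "petals t p q Q P" "edges H = windmill t Q P"
    "windmill t Q P \<subseteq> edges (add_edge G {u, v})" "inj_on ?c (windmill t Q P)"
    by (rule rainbow_copyE[OF H(1) assms(2)])
  obtain i where i: "i < t" "{u, v} \<in> all_pairs (Q \<union> P i)"
    using H(2) QP(2) by (auto simp: windmill_def)
  let ?X = "Q \<union> P i"
  have uv: "u \<in> ?X" "v \<in> ?X" using i(2) by auto
  have sub: "all_pairs ?X \<subseteq> windmill t Q P" using i(1) by (auto simp: windmill_def)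
  have X: "finite ?X" "card ?X = p + q" using petals_card[OF QP(1) i(1)] by auto
  show thesis
  proof (rule that[of "?X - {u, v}"])
    show "finite (?X - {u, v})" using X by simp
    show "card (?X - {u, v}) = p + q - 2"
      using X uv assms(5) by (simp add: card_Diff_subset)
  next
    fix w assume w: "w \<in> ?X - {u, v}"
    then have "{u, w} \<in> windmill t Q P" "{v, w} \<in> windmill t Q P" "{u, v} \<in> windmill t Q P"
      using uv i(2) sub by auto
    moreover have ne: "{u, w} \<noteq> {u, v}" "{v, w} \<noteq> {u, v}"
      using w assms(5) by (auto simp: doubleton_eq_iff)
    ultimately have "?c {u, w} \<noteq> ?c {u, v}" "{u, w} \<in> edges G" "{v, w} \<in> edges G"
      using QP(3) inj_onD[OF QP(4)] unfolding add_edge_def graph.sel by blast+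
    then show "{u, w} \<in> edges G \<and> {v, w} \<in> edges G \<and> c {u, w} \<noteq> \<alpha>"
      using ne(1) by simp
  qed
qed

text \<open>Recoloring the new edge with the color of an edge to a common neighbour \<open>a\<close> of its ends
  forces a clique avoiding \<open>a\<close>, so the ends have one common neighbour more than a clique needs.\<close>

lemma saturated_common_neighbours:
  assumes "rainbow_saturated (friendship_graph t p q) G c" "t \<ge> 1" "p + q \<ge> 3" "simple_graph G"
    and "u \<in> verts G" "v \<in> verts G" "u \<noteq> v" "{u, v} \<notin> edges G"
  shows "card {w. {u, w} \<in> edges G \<and> {v, w} \<in> edges G} \<ge> p + q - 1"
proof -
  let ?N = "{w. {u, w} \<in> edges G \<and> {v, w} \<in> edges G}"
  have "w \<in> verts G" if "{u, w} \<in> edges G" for w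
    using assms(4) that pair_in_all_pairs[of u w "verts G"] unfolding simple_graph_def by blast
  then have "?N \<subseteq> verts G" by blast
  then have fin: "finite ?N" using assms(4) by (auto simp: simple_graph_def intro: finite_subset)
  \<comment> \<open>The color 0 is an arbitrary choice; this call only has to provide one common
    neighbour \<open>a\<close>.\<close>
  obtain W where W: "finite W" "card W = p + q - 2"
    "\<And>w. w \<in> W \<Longrightarrow> {u, w} \<in> edges G \<and> {v, w} \<in> edges G \<and> c {u, w} \<noteq> 0"
    by (rule saturated_common_neighbours_avoiding[OF assms(1,2,5-8), of 0]) simp_all
  then have "W \<noteq> {}" using assms(3) by auto
  then obtain a where a: "a \<in> W" by blast
  obtain W' where W': "finite W'" "card W' = p + q - 2"
    "\<And>w. w \<in> W' \<Longrightarrow> {u, w} \<in> edges G \<and> {v, w} \<in> edges G \<and> c {u, w} \<noteq> c {u, a}"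
    by (rule saturated_common_neighbours_avoiding[OF assms(1,2,5-8), of "c {u, a}"]) simp_all
  have "a \<notin> W'"
  proof
    assume "a \<in> W'"
    from W'(3)[OF this] show False by simp
  qed
  then have "card (insert a W') = p + q - 1" using W'(1,2) assms(3) by simp
  moreover have "w \<in> ?N" if "w \<in> W'" for w
    using W'(3)[OF that] by simp
  then have "insert a W' \<subseteq> ?N" using W(3)[OF a] by auto
  then have "card (insert a W') \<le> card ?N" by (rule card_mono[OF fin])
  ultimately show ?thesis by simp
qed

text \<open>If all degrees are at least \<open>2 * d\<close>, the degree sum gives \<open>d\<close>
  edges per vertex. Otherwise some \<open>v\<close> has fewer than \<open>2 * d\<close> neighbours,
  and each of the remaining vertices sends \<open>d\<close> edges into the neighbourhood of
  \<open>v\<close>.\<close>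

lemma edges_lower_bound:
  assumes G: "simple_graph G"
    and common: "\<And>u v. \<lbrakk>u \<in> verts G; v \<in> verts G; u \<noteq> v; {u, v} \<notin> edges G\<rbrakk>
      \<Longrightarrow> card {w. {u, w} \<in> edges G \<and> {v, w} \<in> edges G} \<ge> d"
  shows "d * (card (verts G) - 2 * d) \<le> card (edges G)"
proof -
  have finV: "finite (verts G)" and E: "edges G \<subseteq> all_pairs (verts G)"
    using G by (auto simp: simple_graph_def)
  have finE: "finite (edges G)" using finite_subset[OF E] finV by simp
  show ?thesis
  proof (cases "\<forall>v\<in>verts G. 2 * d \<le> card {e \<in> edges G. v \<in> e}")
    case True
    have "card {v \<in> verts G. v \<in> e} = 2" if "e \<in> edges G" for e
    proof -
      have "{v \<in> verts G. v \<in> e} = e" "card e = 2"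
        using that E by (auto simp: all_pairs_def)
      then show ?thesis by simp
    qed
    then have "(\<Sum>v\<in>verts G. card {e \<in> edges G. v \<in> e}) = 2 * card (edges G)"
      using finV finE by (intro sum_multicount) auto
    moreover have "(\<Sum>v\<in>verts G. 2 * d) \<le> (\<Sum>v\<in>verts G. card {e \<in> edges G. v \<in> e})"
      using True by (intro sum_mono) auto
    ultimately have "d * card (verts G) \<le> card (edges G)" by (simp add: mult.commute)
    then show ?thesis
      by (meson diff_le_self le_trans mult_le_mono2)
  next
    case False
    then obtain v where v: "v \<in> verts G" "card {e \<in> edges G. v \<in> e} < 2 * d" by auto
    define N where "N = {w. {v, w} \<in> edges G}"
    have NV: "N \<subseteq> verts G" "v \<notin> N"
      using E pair_in_all_pairs[of v _ "verts G"] unfolding N_def by blast+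
    have finN: "finite N" using NV(1) finV by (rule finite_subset)
    have "(\<lambda>w. {v, w}) ` N \<subseteq> {e \<in> edges G. v \<in> e}" by (auto simp: N_def)
    moreover have "inj_on (\<lambda>w. {v, w}) N" by (auto simp: inj_on_def doubleton_eq_iff)
    ultimately have cN: "card N < 2 * d"
      using v(2) card_inj_on_le[of "\<lambda>w. {v, w}" N "{e \<in> edges G. v \<in> e}"] finE by simp
    define U where "U = verts G - insert v N"
    have "card U = card (verts G) - card (insert v N)"
      unfolding U_def using finN NV v(1) by (intro card_Diff_subset) auto
    \<comment> \<open>The strict bound on \<open>card N\<close> makes room for \<open>v\<close>
      itself.\<close>
    then have cU: "card (verts G) - 2 * d \<le> card U" using cN finN NV(2) by simp
    have finU: "finite U" using finV by (simp add: U_def)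
    let ?B = "\<lambda>u. {w \<in> N. {u, w} \<in> edges G}"
    have "d \<le> card (?B u)" if "u \<in> U" for u
    proof -
      have "{w. {v, w} \<in> edges G \<and> {u, w} \<in> edges G} = ?B u" by (auto simp: N_def)
      moreover have "d \<le> card {w. {v, w} \<in> edges G \<and> {u, w} \<in> edges G}"
        using common[of v u] that v(1) by (auto simp: U_def N_def)
      ultimately show ?thesis by simp
    qed
    then have "(\<Sum>u\<in>U. d) \<le> (\<Sum>u\<in>U. card (?B u))" by (intro sum_mono)
    also have "\<dots> = card (Sigma U ?B)"
      using finU finN by simp
    also have "\<dots> \<le> card (edges G)"
    proof (rule card_inj_on_le[OF _ _ finE])
      show "inj_on (\<lambda>(u, w). {u, w}) (Sigma U ?B)"
        by (auto simp: inj_on_def doubleton_eq_iff U_def)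
      show "(\<lambda>(u, w). {u, w}) ` Sigma U ?B \<subseteq> edges G" by auto
    qed
    finally have "d * card U \<le> card (edges G)" by (simp add: mult.commute)
    then show ?thesis using cU by (meson le_trans mult_le_mono2)
  qed
qed

subsection \<open>Completing a partially saturated graph\<close>

text \<open>Add as many edges of \<open>W\<close> as possible without creating a rainbow copy.\<close>

lemma saturated_extension:
  assumes fin: "finite (verts G\<^sub>0)" "finite W" "W \<subseteq> all_pairs (verts G\<^sub>0)"
    and G0: "edges G\<^sub>0 \<subseteq> all_pairs (verts G\<^sub>0)"
    and free: "\<nexists>H. rainbow_copy F G\<^sub>0 c\<^sub>0 H"
    and sat: "\<And>e \<alpha>. e \<in> nonedges G\<^sub>0 \<Longrightarrow> e \<notin> W \<Longrightarrow>
      \<exists>H. rainbow_copy F (add_edge G\<^sub>0 e) (c\<^sub>0(e := \<alpha>)) H \<and> e \<in> edges H"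
  obtains G c where "verts G = verts G\<^sub>0" "edges G \<subseteq> edges G\<^sub>0 \<union> W" "simple_graph G"
    "rainbow_saturated F G c"
proof -
  let ?V = "verts G\<^sub>0"
  \<comment> \<open>Only the colors on \<open>edges G\<^sub>0\<close> are fixed; those of the added
    edges may be chosen afresh for every \<open>E\<close>.\<close>
  define good where "good = (\<lambda>E. edges G\<^sub>0 \<subseteq> E \<and> E \<subseteq> edges G\<^sub>0 \<union> W \<and>
    (\<exists>c. (\<forall>e\<in>edges G\<^sub>0. c e = c\<^sub>0 e) \<and> (\<nexists>H. rainbow_copy F (Graph ?V E) c H)))"
  have finE: "finite (edges G\<^sub>0 \<union> W)"
    using fin finite_subset[OF G0] by auto
  have "good (edges G\<^sub>0)" using free by (cases G\<^sub>0) (auto simp: good_def)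
  moreover have "\<forall>E. good E \<longrightarrow> card E < Suc (card (edges G\<^sub>0 \<union> W))"
    using card_mono[OF finE] by (auto simp: good_def less_Suc_eq_le)
  ultimately obtain E where E: "good E" and max: "\<And>E'. good E' \<Longrightarrow> card E' \<le> card E"
    using ex_has_greatest_nat[of good "edges G\<^sub>0" card "Suc (card (edges G\<^sub>0 \<union> W))"]
    by blast
  obtain c where c: "\<And>e. e \<in> edges G\<^sub>0 \<Longrightarrow> c e = c\<^sub>0 e"
    and cfree: "\<nexists>H. rainbow_copy F (Graph ?V E) c H"
    using E unfolding good_def by blast
  have Esub: "edges G\<^sub>0 \<subseteq> E" "E \<subseteq> edges G\<^sub>0 \<union> W" using E by (auto simp: good_def)
  have "finite E" using Esub(2) finE by (rule finite_subset)
  have sat': "\<exists>H. rainbow_copy F (add_edge (Graph ?V E) e) (c(e := \<alpha>)) H \<and> e \<in> edges H"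
    if e: "e \<in> nonedges (Graph ?V E)" for e \<alpha>
  proof (cases "e \<in> W")
    case False
    \<comment> \<open>The copy in \<open>G\<^sub>0\<close> plus \<open>e\<close> survives, since
      \<open>c\<close> agrees with \<open>c\<^sub>0\<close> on the old edges.\<close>
    have "e \<in> nonedges G\<^sub>0" using e Esub by (auto simp: nonedges_def)
    then obtain H where H: "rainbow_copy F (add_edge G\<^sub>0 e) (c\<^sub>0(e := \<alpha>)) H" "e \<in> edges H"
      using sat False by blast
    have "(c(e := \<alpha>)) e' = (c\<^sub>0(e := \<alpha>)) e'" if "e' \<in> edges H" for e'
      using that H(1) c by (auto simp: rainbow_copy_def subgraph_def add_edge_def)
    then have "inj_on (c(e := \<alpha>)) (edges H)"
      using H(1) inj_on_cong[of "edges H" "c(e := \<alpha>)" "c\<^sub>0(e := \<alpha>)"]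
      by (simp add: rainbow_copy_def rainbow_def)
    then have "rainbow_copy F (add_edge (Graph ?V E) e) (c(e := \<alpha>)) H"
      using H(1) Esub by (auto simp: rainbow_copy_def rainbow_def subgraph_def add_edge_def)
    then show ?thesis using H(2) by blast
  next
    case True
    have eE: "e \<notin> E" using e by (simp add: nonedges_def)
    \<comment> \<open>By maximality every color of \<open>e\<close> creates a rainbow copy. It uses
      \<open>e\<close>, as otherwise it would already be present in \<open>E\<close>.\<close>
    have "\<not> good (insert e E)"
      using max[of "insert e E"] eE \<open>finite E\<close> by auto
    moreover have "good (insert e E)" if "\<nexists>H. rainbow_copy F (Graph ?V (insert e E)) (c(e := \<alpha>)) H"
      unfolding good_def
    proof (intro conjI exI[of _ "c(e := \<alpha>)"] ballI)
      show "(c(e := \<alpha>)) e' = c\<^sub>0 e'" if "e' \<in> edges G\<^sub>0" for e'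
        using that eE Esub c by auto
    qed (use that Esub True in auto)
    ultimately obtain H where H: "rainbow_copy F (Graph ?V (insert e E)) (c(e := \<alpha>)) H"
      by blast
    have "e \<in> edges H"
    proof (rule ccontr)
      assume ne: "e \<notin> edges H"
      have "inj_on (c(e := \<alpha>)) (edges H)"
        using H by (simp add: rainbow_copy_def rainbow_def)
      moreover have "(c(e := \<alpha>)) a = c a" if "a \<in> edges H" for a
        using ne that by auto
      ultimately have "inj_on c (edges H)"
        using inj_on_cong[of "edges H" "c(e := \<alpha>)" c] by blast
      then have "rainbow_copy F (Graph ?V E) c H"
        using H ne by (auto simp: rainbow_copy_def rainbow_def subgraph_def)
      then show False using cfree by blast
    qed
    then show ?thesis using H by (auto simp: add_edge_def)
  qed
  show thesis
  proof (rule that[of "Graph ?V E" c])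
    show "simple_graph (Graph ?V E)"
      using fin G0 Esub by (auto simp: simple_graph_def)
    show "rainbow_saturated F (Graph ?V E) c"
      using cfree sat' by (simp add: rainbow_saturated_def)
  qed (use Esub in auto)
qed

subsection \<open>Block colorings\<close>

lemma injection_into:
  assumes "finite A" "finite B" "card A \<le> card B"
  obtains f where "inj_on f A" "f ` A \<subseteq> B"
  using assms inj_on_iff_card_le[of A B] by blast

text \<open>Row 0 receives \<epsilon> at \<open>e\<^sub>0\<close> and fills its other places from a
  set \<open>A0\<close> of exactly \<open>card T - 1\<close> colors that contains \<open>Z\<close>.
  The later rows draw from the remaining colors and hence avoid \<open>Z\<close>; no color is
  wasted, so \<open>k * card T\<close> colors suffice.\<close>

lemma joint_injection:
  fixes A :: "'c set" and T :: "'e set"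
  assumes fin: "finite A" "finite T" and k: "k \<ge> 1" and cA: "k * card T \<le> card A"
    and e0: "e\<^sub>0 \<in> T" and \<epsilon>: "\<epsilon> \<in> A" and Z: "Z \<subseteq> A - {\<epsilon>}" "card Z < card T"
  obtains \<psi> :: "nat \<Rightarrow> 'e \<Rightarrow> 'c" where
    "inj_on (\<lambda>(i, e). \<psi> i e) ({..<k} \<times> T)"
    "\<And>i e. i < k \<Longrightarrow> e \<in> T \<Longrightarrow> \<psi> i e \<in> A"
    "\<psi> 0 e\<^sub>0 = \<epsilon>"
    "\<And>i e. 0 < i \<Longrightarrow> i < k \<Longrightarrow> e \<in> T \<Longrightarrow> \<psi> i e \<notin> Z"
proof -
  have finZ: "finite Z" using Z(1) fin(1) by (meson finite_Diff finite_subset)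
  have cT: "card T \<le> card A" using cA k by (metis le_trans mult_le_mono1 nat_mult_1)
  have "card (A - {\<epsilon>} - Z) = card A - 1 - card Z"
    using fin(1) finZ Z(1) \<epsilon> by (simp add: card_Diff_subset)
  then have "card T - 1 - card Z \<le> card (A - {\<epsilon>} - Z)" using cT by simp
  then obtain B where B: "B \<subseteq> A - {\<epsilon>} - Z" "card B = card T - 1 - card Z" "finite B"
    by (rule obtain_subset_with_card_n)
  define A0 where "A0 = Z \<union> B"
  have A0: "A0 \<subseteq> A - {\<epsilon>}" "finite A0" using Z(1) B finZ by (auto simp: A0_def)
  have cA0: "card A0 = card T - 1"
    using B Z finZ unfolding A0_def by (subst card_Un_disjoint) auto
  obtain f where f: "inj_on f (T - {e\<^sub>0})" "f ` (T - {e\<^sub>0}) \<subseteq> A0"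
    by (rule injection_into[of "T - {e\<^sub>0}" A0]) (use fin A0 cA0 e0 in auto)
  have cT0: "card T > 0" using e0 fin by (auto simp: card_gt_0_iff)
  have "card (A - {\<epsilon>} - A0) = card A - 1 - (card T - 1)"
    using fin(1) A0 cA0 \<epsilon> by (simp add: card_Diff_subset)
  moreover have "(k - 1) * card T = k * card T - card T" by (simp add: diff_mult_distrib)
  ultimately have "card ({1..<k} \<times> T) \<le> card (A - {\<epsilon>} - A0)"
    using cA cT0 by (simp add: card_cartesian_product)
  then obtain g where g: "inj_on g ({1..<k} \<times> T)" "g ` ({1..<k} \<times> T) \<subseteq> A - {\<epsilon>} - A0"
    using injection_into[of "{1..<k} \<times> T" "A - {\<epsilon>} - A0"] fin by auto
  define \<psi> where "\<psi> = (\<lambda>i e. if i = 0 then (if e = e\<^sub>0 then \<epsilon> else f e) else g (i, e))"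
  have f': "f e \<in> A0" "f e \<noteq> \<epsilon>" if "e \<in> T" "e \<noteq> e\<^sub>0" for e
    using f(2) that A0 by auto
  have g': "g (i, e) \<in> A" "g (i, e) \<noteq> \<epsilon>" "g (i, e) \<notin> A0" if "0 < i" "i < k" "e \<in> T" for i e
  proof -
    have "(i, e) \<in> {1..<k} \<times> T" using that by simp
    then show "g (i, e) \<in> A" "g (i, e) \<noteq> \<epsilon>" "g (i, e) \<notin> A0" using g(2) by blast+
  qed
  show thesis
  proof (rule that[of \<psi>])
    show "inj_on (\<lambda>(i, e). \<psi> i e) ({..<k} \<times> T)"
    proof (rule inj_onI, clarify)
      fix i e j e' assume *: "i < k" "e \<in> T" "j < k" "e' \<in> T" "\<psi> i e = \<psi> j e'"
      consider "i = 0" "j = 0" | "i = 0" "j > 0" | "i > 0" "j = 0" | "i > 0" "j > 0" by fastforce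
      then show "i = j \<and> e = e'"
      proof cases
        case 1
        then show ?thesis using * f'[of e] f'[of e'] inj_onD[OF f(1), of e e']
          by (auto simp: \<psi>_def split: if_splits)
      next
        case 2
        then show ?thesis using * f'[of e] g'[of j e'] by (auto simp: \<psi>_def split: if_splits)
      next
        case 3
        then show ?thesis using * f'[of e'] g'[of i e] by (auto simp: \<psi>_def split: if_splits)
      next
        case 4
        then show ?thesis using * inj_onD[OF g(1), of "(i, e)" "(j, e')"] by (auto simp: \<psi>_def)
      qed
    qed
    show "\<psi> i e \<in> A" if "i < k" "e \<in> T" for i e
      using that f'[of e] g'[of i e] \<epsilon> A0(1) by (auto simp: \<psi>_def)
    show "\<psi> 0 e\<^sub>0 = \<epsilon>" by (simp add: \<psi>_def)
    show "\<psi> i e \<notin> Z" if "0 < i" "i < k" "e \<in> T" for i e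
      using that g'[of i e] by (auto simp: \<psi>_def A0_def)
  qed
qed

lemma choose_two_add: "(a + b) choose 2 = (a choose 2) + (b choose 2) + a * b"
  by (induction a) (simp_all add: numeral_2_eq_2)

text \<open>\<open>S\<close> is the set of \<open>s = p + q - 1\<close> vertices joined to everything. Edges inside \<open>S\<close> (\<open>hub\<close>, empty
  if \<open>s = 2\<close>, because then the color of the only such edge could not be avoided) and edges from \<open>S\<close>
  to vertices outside the blocks get their \<open>own\<close> color, which is even; the remaining colors come
  from the odd palette \<open>R\<close>, whose size makes \<open>hub\<close> and \<open>R\<close> together one color short of a rainbow
  copy. The set \<open>D\<^sub>0\<close> is the template of a block, and \<open>m\<close> counts the edges which a petal adds.
  The last condition of \<open>valid\<close> makes a block colored with some color of \<open>R - P\<close> incompatible with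
  the full clique \<open>S\<close>, but not with \<open>S\<close> minus a suitable vertex.\<close>

locale friendship =
  fixes t p q :: nat
  assumes t2: "t \<ge> 2" and p2: "p \<ge> 2" and q1: "q \<ge> 1"
begin

definition s :: nat where "s = p + q - 1"
definition S :: "nat set" where "S = {..<s}"
definition m :: nat where "m = ((p + q) choose 2) - (q choose 2)"
definition D\<^sub>0 :: "nat set" where "D\<^sub>0 = {s..<s + p}"
definition hub :: "nat set set" where "hub = (if s = 2 then {} else all_pairs S)"
definition own :: "nat set \<Rightarrow> nat" where "own e = 2 * set_encode e"
definition P :: "nat set" where
  "P = (\<lambda>i. 2 * i + 1) ` {..<if s = 2 then 3 * t - 1 else (t - 1) * m - 1}"
definition R :: "nat set" where
  "R = (\<lambda>i. 2 * i + 1) ` {..<if s = 2 then 3 * t - 1 else (t - 1) * m - 1 + s}"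

definition new_pairs :: "nat set \<Rightarrow> nat set set" where
  "new_pairs Q = all_pairs (Q \<union> D\<^sub>0) - all_pairs Q"

definition valid :: "(nat set \<Rightarrow> nat) \<Rightarrow> bool" where
  "valid \<psi> \<longleftrightarrow> (\<forall>e\<in>all_pairs D\<^sub>0. \<psi> e \<in> R \<union> own ` hub) \<and>
     (\<forall>y\<in>D\<^sub>0. inj_on (\<lambda>x. \<psi> {x, y}) S \<and> (\<forall>x\<in>S. \<psi> {x, y} \<in> R)) \<and>
     ((\<exists>e\<in>new_pairs S. \<psi> e \<in> R - P) \<longrightarrow> (\<exists>e\<in>all_pairs D\<^sub>0. \<psi> e \<in> own ` hub))"

section \<open>Arithmetic of the parameters\<close>

lemma s2: "s \<ge> 2" and sq: "q < s" and Suc_s: "p + q = Suc s"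
  using p2 q1 by (simp_all add: s_def)

lemma s_eq_2D: "s = 2 \<Longrightarrow> p = 2 \<and> q = 1"
  using p2 q1 by (auto simp: s_def)

lemma m_eq: "m = (p choose 2) + p * q"
  by (simp add: m_def choose_two_add)

text \<open>Serves to place all reserved colors \<open>R - P\<close>, of which there are at most
  \<open>s\<close>, on the pairs of a single petal, with one pair to spare for a color of
  \<open>hub\<close>.\<close>

lemma m_gt: "m > s"
proof -
  obtain p' q' where pq: "p = Suc (Suc p')" "q = Suc q'"
    using p2 q1 by (metis Suc_le_D numeral_2_eq_2 One_nat_def Suc_le_mono)
  have "p choose 2 \<ge> Suc p'" by (simp add: pq numeral_2_eq_2)
  moreover have "p * q \<ge> p + q' * 2" by (simp add: pq)
  ultimately show ?thesis unfolding m_eq s_def using pq by linarith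
qed

lemma choose_r: "(p + q) choose 2 = (s choose 2) + s"
  by (simp add: Suc_s numeral_2_eq_2)

text \<open>Both sides count the pairs in a clique on \<open>p + q = Suc s\<close> vertices, split
  off a kernel or off a single vertex.\<close>

lemma choose_q_m: "(q choose 2) + m = (s choose 2) + s"
  using choose_r by (simp add: m_eq choose_two_add)

lemma odd_card: "card ((\<lambda>i::nat. 2 * i + 1) ` {..<n}) = n"
  by (subst card_image) (auto simp: inj_on_def)

lemma P_subset: "P \<subseteq> R" and finite_R [simp]: "finite R" and finite_P [simp]: "finite P"
  by (auto simp: P_def R_def)

lemma card_P: "card P = (if s = 2 then 3 * t - 1 else (t - 1) * m - 1)"
  and card_R: "card R = (if s = 2 then 3 * t - 1 else (t - 1) * m - 1 + s)"
  unfolding P_def R_def by (simp_all only: odd_card)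

lemma t_m: "t * m = m + (t - 1) * m"
  using t2 by (cases t) auto

lemma m_le: "m \<le> (t - 1) * m"
proof -
  have "1 * m \<le> (t - 1) * m" using t2 by (intro mult_le_mono1) simp
  then show ?thesis by simp
qed

lemma s_le_card_P: "s \<le> card P"
proof -
  define M where "M = (t - 1) * m"
  have "m \<le> M" using m_le by (simp only: M_def)
  then show ?thesis using m_gt t2 unfolding card_P M_def[symmetric] by auto
qed

lemma finite_S [simp]: "finite S" and card_S [simp]: "card S = s"
  by (simp_all add: S_def)

lemma finite_D0 [simp]: "finite D\<^sub>0" and card_D0 [simp]: "card D\<^sub>0 = p"
  by (simp_all add: D\<^sub>0_def)

lemma S_D0: "S \<inter> D\<^sub>0 = {}"
  by (auto simp: S_def D\<^sub>0_def)

lemma finite_hub [simp]: "finite hub"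
  by (simp add: hub_def)

lemma card_hub: "card hub = (if s = 2 then 0 else s choose 2)"
  by (simp add: hub_def card_all_pairs)

lemma m_s2: "s = 2 \<Longrightarrow> m = 3"
  using s_eq_2D unfolding m_eq by (simp add: numeral_2_eq_2)

text \<open>The gap is exactly one. For \<open>s \<noteq> 2\<close> this is
  \<open>choose_q_m\<close>; for \<open>s = 2\<close> the hub is empty, \<open>m = 3\<close>, and
  \<open>3 * t - 1\<close> colors face \<open>3 * t\<close> edges.\<close>

lemma card_hub_R: "card hub + card R < (q choose 2) + t * m"
proof -
  define M where "M = (t - 1) * m"
  have M: "m \<le> M" using m_le by (simp only: M_def)
  show ?thesis
  proof (cases "s = 2")
    case True
    then show ?thesis using m_s2 t2 unfolding card_hub card_R by simp
  next
    case False
    then show ?thesis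
      using choose_q_m m_gt M unfolding card_hub card_R t_m M_def[symmetric] by simp
  qed
qed

text \<open>The same count as before, with the \<open>s\<close> spokes of an outer vertex in place
  of the \<open>s\<close> reserved colors.\<close>

lemma card_hub_P: "s \<noteq> 2 \<Longrightarrow> s + card hub + card P < (q choose 2) + t * m"
proof -
  define M where "M = (t - 1) * m"
  have M: "m \<le> M" using m_le by (simp only: M_def)
  show "s + card hub + card P < (q choose 2) + t * m" if "s \<noteq> 2"
    using that choose_q_m m_gt M unfolding card_hub card_P t_m M_def[symmetric] by simp
qed

lemma own_even: "even (own e)" by (simp add: own_def)

lemma R_odd: "x \<in> R \<Longrightarrow> odd x" by (auto simp: R_def)

lemma own_notin_R [simp]: "own e \<notin> R" using own_even R_odd by blast

lemma own_inject: "finite e \<Longrightarrow> finite e' \<Longrightarrow> own e = own e' \<longleftrightarrow> e = e'"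
  by (simp add: own_def set_encode_eq)

lemma finite_new_pairs [simp]: "finite Q \<Longrightarrow> finite (new_pairs Q)"
  by (simp add: new_pairs_def)

lemma card_new_pairs_D0: "Q \<subseteq> S \<Longrightarrow> card Q = q \<Longrightarrow> card (new_pairs Q) = m"
  using S_D0 finite_subset[of Q S]
  unfolding new_pairs_def by (subst card_new_pairs) (auto simp: m_def)

lemma new_pairsE:
  assumes "e \<in> new_pairs Q"
  obtains "e \<in> all_pairs D\<^sub>0" | x y where "e = {x, y}" "x \<in> Q" "y \<in> D\<^sub>0"
proof -
  obtain u v where uv: "e = {u, v}" "u \<in> Q \<union> D\<^sub>0" "v \<in> Q \<union> D\<^sub>0" "u \<noteq> v"
    and ne: "e \<notin> all_pairs Q"
    using assms unfolding new_pairs_def by (blast elim: all_pairsE)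
  consider "u \<in> D\<^sub>0" "v \<in> D\<^sub>0" | "u \<in> Q" "v \<in> D\<^sub>0" | "v \<in> Q" "u \<in> D\<^sub>0"
    using uv ne by auto
  then show thesis
  proof cases
    case 1
    then show thesis using uv that(1) by simp
  next
    case 2
    then show thesis using uv(1) that(2) by blast
  next
    case 3
    then show thesis using uv(1) that(2)[of v u] by blast
  qed
qed

lemma pairs_D0_subset:
  assumes "Q \<subseteq> S"
  shows "all_pairs D\<^sub>0 \<subseteq> new_pairs Q"
proof
  fix e assume "e \<in> all_pairs D\<^sub>0"
  then obtain x y where "e = {x, y}" "x \<in> D\<^sub>0" "y \<in> D\<^sub>0" "x \<noteq> y" by (rule all_pairsE)
  then show "e \<in> new_pairs Q" using assms S_D0 by (auto simp: new_pairs_def)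
qed

lemma cross_pair_new: "x \<in> Q \<Longrightarrow> Q \<subseteq> S \<Longrightarrow> y \<in> D\<^sub>0 \<Longrightarrow> {x, y} \<in> new_pairs Q"
  using S_D0 by (auto simp: new_pairs_def)

text \<open>Made for a copy with kernel \<open>Q\<close> that has \<open>t - 1\<close> blocks as
  petals. All reserved colors are confined to block 0, which also carries \<epsilon>, so the last
  condition of \<open>valid\<close> holds. Pairs from \<open>S - Q\<close> to a block lie outside
  the copy and are colored from \<open>P\<close>.\<close>

lemma block_colorings:
  assumes Q: "Q \<subseteq> S" "card Q = q" and A: "A \<subseteq> R"
    and cA: "(t - 1) * m \<le> card (if s = 2 then A else insert \<epsilon> A)"
    and \<epsilon>: "s \<noteq> 2 \<Longrightarrow> \<epsilon> \<in> own ` hub"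
  obtains \<psi> where "\<And>i. i < t - 1 \<Longrightarrow> valid (\<psi> i)"
    "inj_on (\<lambda>(i, e). \<psi> i e) ({..<t - 1} \<times> new_pairs Q)"
    "\<And>i e. i < t - 1 \<Longrightarrow> e \<in> new_pairs Q \<Longrightarrow> \<psi> i e \<in> (if s = 2 then A else insert \<epsilon> A)"
proof -
  let ?A = "if s = 2 then A else insert \<epsilon> A"
  have finQ: "finite Q" and finA: "finite A"
    using Q(1) A finite_S finite_R by (blast intro: finite_subset)+
  let ?e0 = "{s, Suc s}"
  have e0: "?e0 \<in> all_pairs D\<^sub>0" using p2 by (simp add: D\<^sub>0_def)
  note pairs_D0 = pairs_D0_subset[OF Q(1)]
  have "m > 0" using m_gt by simp
  then have "card ?A > 0" using m_le cA by linarith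
  \<comment> \<open>The color prescribed at \<open>?e0\<close>. For \<open>s = 2\<close> there is no
    hub color, and any available color serves.\<close>
  then obtain \<delta> where \<delta>: "\<delta> \<in> ?A" "s \<noteq> 2 \<Longrightarrow> \<delta> = \<epsilon>"
    by (cases "s = 2") (auto simp: card_gt_0_iff)
  have "s \<noteq> 2 \<Longrightarrow> \<epsilon> \<notin> R" using \<epsilon> by auto
  then have Z: "?A \<inter> (R - P) \<subseteq> ?A - {\<delta>}" "card (?A \<inter> (R - P)) < card (new_pairs Q)"
  proof -
    have RP: "s = 2 \<Longrightarrow> R = P" by (simp add: R_def P_def)
    show "?A \<inter> (R - P) \<subseteq> ?A - {\<delta>}" using \<delta> RP \<open>s \<noteq> 2 \<Longrightarrow> \<epsilon> \<notin> R\<close> by auto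
    have "card (?A \<inter> (R - P)) \<le> card (R - P)" by (intro card_mono) auto
    also have "\<dots> = card R - card P" by (intro card_Diff_subset) (auto simp: P_subset)
    also have "\<dots> < m" using m_gt by (auto simp: card_R card_P)
    finally show "card (?A \<inter> (R - P)) < card (new_pairs Q)"
      using card_new_pairs_D0[OF Q] by simp
  qed
  obtain \<psi> where \<psi>: "inj_on (\<lambda>(i, e). \<psi> i e) ({..<t - 1} \<times> new_pairs Q)"
    "\<And>i e. i < t - 1 \<Longrightarrow> e \<in> new_pairs Q \<Longrightarrow> \<psi> i e \<in> ?A"
    "\<psi> 0 ?e0 = \<delta>"
    "\<And>i e. 0 < i \<Longrightarrow> i < t - 1 \<Longrightarrow> e \<in> new_pairs Q \<Longrightarrow> \<psi> i e \<notin> ?A \<inter> (R - P)"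
  proof (rule joint_injection[of ?A "new_pairs Q" "t - 1" ?e0 \<delta> "?A \<inter> (R - P)"])
    show "?e0 \<in> new_pairs Q" using e0 pairs_D0 by blast
    show "(t - 1) * card (new_pairs Q) \<le> card ?A" using cA card_new_pairs_D0[OF Q] by simp
  qed (use finA finQ t2 \<delta> Z in auto)
  \<comment> \<open>By joint injectivity \<epsilon> occurs only at \<open>?e0\<close> in block 0. As
    \<open>?e0\<close> lies inside the block, all pairs to \<open>Q\<close> get colors of
    \<open>R\<close>.\<close>
  have inA: "\<psi> i e \<in> R" if "i < t - 1" "e \<in> new_pairs Q" "i \<noteq> 0 \<or> e \<noteq> ?e0" for i e
  proof -
    have "0 < t - 1" "?e0 \<in> new_pairs Q" using t2 e0 pairs_D0 by auto
    then have "s \<noteq> 2 \<Longrightarrow> \<psi> i e \<noteq> \<epsilon>"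
      using inj_onD[OF \<psi>(1), of "(i, e)" "(0, ?e0)"] that \<psi>(3) \<delta>(2) by auto
    then show ?thesis using \<psi>(2)[OF that(1,2)] A by (auto split: if_splits)
  qed
  \<comment> \<open>At a block vertex \<open>y\<close> the kernel takes at most \<open>q\<close>
    colors and \<open>s - q\<close> more are needed; \<open>P\<close> has at least
    \<open>s\<close>.\<close>
  have "\<exists>h. inj_on h (S - Q) \<and> h ` (S - Q) \<subseteq> P - (\<lambda>x. \<psi> i {x, y}) ` Q" for i y
  proof -
    have "card ((\<lambda>x. \<psi> i {x, y}) ` Q) \<le> q" using card_image_le[OF finQ] Q(2) by metis
    moreover have "card P - card ((\<lambda>x. \<psi> i {x, y}) ` Q) \<le> card (P - (\<lambda>x. \<psi> i {x, y}) ` Q)"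
      using finQ by (intro diff_card_le_card_Diff) simp
    moreover have "card (S - Q) = s - q" using Q finQ by (simp add: card_Diff_subset)
    ultimately have "card (S - Q) \<le> card (P - (\<lambda>x. \<psi> i {x, y}) ` Q)"
      using s_le_card_P by linarith
    then show ?thesis by (metis injection_into finite_Diff finite_S finite_P)
  qed
  then obtain h where h: "\<And>i y. inj_on (h i y) (S - Q)"
    "\<And>i y. h i y ` (S - Q) \<subseteq> P - (\<lambda>x. \<psi> i {x, y}) ` Q" by metis
  \<comment> \<open>The relevant pairs outside \<open>new_pairs Q\<close> are \<open>{x, y}\<close>
    with \<open>x \<in> S - Q\<close> and \<open>y \<in> D\<^sub>0\<close>, where
    \<open>x < y\<close>; so \<open>Min\<close> and \<open>Max\<close> recover the ends.\<close>
  define \<psi>' where "\<psi>' = (\<lambda>i e. if e \<in> new_pairs Q then \<psi> i e else h i (Max e) (Min e))"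
  note in_Q = cross_pair_new[OF _ Q(1)]
  have out_Q: "\<psi>' i {x, y} = h i y x" if "x \<in> S - Q" "y \<in> D\<^sub>0" for x y i
  proof -
    have "x < y" using that by (auto simp: S_def D\<^sub>0_def)
    then show ?thesis using that S_D0 by (auto simp: \<psi>'_def new_pairs_def)
  qed
  have valid: "valid (\<psi>' i)" if i: "i < t - 1" for i
    unfolding valid_def
  proof (intro conjI ballI impI)
    fix e assume e: "e \<in> all_pairs D\<^sub>0"
    then have e': "e \<in> new_pairs Q" using pairs_D0 by blast
    show "\<psi>' i e \<in> R \<union> own ` hub"
      using \<psi>(2)[OF i e'] A \<epsilon> e' by (auto simp: \<psi>'_def split: if_splits)
  next
    fix y assume y: "y \<in> D\<^sub>0"
    have yQ: "\<psi>' i {x, y} = \<psi> i {x, y}" if "x \<in> Q" for x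
      using in_Q[OF that y] by (simp add: \<psi>'_def)
    have hx: "h i y x \<in> P" "x' \<in> Q \<Longrightarrow> h i y x \<noteq> \<psi> i {x', y}" if "x \<in> S - Q" for x x'
    proof -
      have "h i y x \<in> P - (\<lambda>x. \<psi> i {x, y}) ` Q" using h(2) that by blast
      then show "h i y x \<in> P" "x' \<in> Q \<Longrightarrow> h i y x \<noteq> \<psi> i {x', y}" by auto
    qed
    show "inj_on (\<lambda>x. \<psi>' i {x, y}) S"
    proof (rule inj_onI)
      fix x x' assume x: "x \<in> S" "x' \<in> S" "\<psi>' i {x, y} = \<psi>' i {x', y}"
      consider "x \<in> Q" "x' \<in> Q" | "x \<in> Q" "x' \<notin> Q" | "x \<notin> Q" "x' \<in> Q" | "x \<notin> Q" "x' \<notin> Q" by blast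
      then show "x = x'"
      proof cases
        case 1
        then have "{x, y} = {x', y}"
          using inj_onD[OF \<psi>(1), of "(i, {x, y})" "(i, {x', y})"] in_Q y x(3) yQ i by simp
        then show ?thesis by (auto simp: doubleton_eq_iff)
      next
        case 2
        then show ?thesis using x hx(2)[of x' x] yQ out_Q[of x' y i] y by simp
      next
        case 3
        then show ?thesis using x hx(2)[of x x'] yQ out_Q[of x y i] y by simp
      next
        case 4
        then show ?thesis using x out_Q[of _ y i] y inj_onD[OF h(1)[of i y], of x x'] by simp
      qed
    qed
    fix x assume x: "x \<in> S"
    show "\<psi>' i {x, y} \<in> R"
    proof (cases "x \<in> Q")
      case True
      have "x \<notin> ?e0" using x by (auto simp: S_def)
      then show ?thesis using True yQ inA[OF i in_Q[OF True y]] by auto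
    next
      case False
      then show ?thesis using hx(1)[of x] out_Q[of x y i] x y P_subset by auto
    qed
  next
    assume "\<exists>e\<in>new_pairs S. \<psi>' i e \<in> R - P"
    then obtain e where e: "e \<in> new_pairs S" "\<psi>' i e \<in> R - P" by blast
    \<comment> \<open>The values of \<open>h\<close> lie in \<open>P\<close>, so a reserved color
      can only sit on a pair of \<open>new_pairs Q\<close>, and there only in block 0.\<close>
    have eQ: "e \<in> new_pairs Q"
    proof (rule ccontr)
      assume ne: "e \<notin> new_pairs Q"
      obtain x y where xy: "e = {x, y}" "x \<in> S" "y \<in> D\<^sub>0"
        using new_pairsE[OF e(1)] ne pairs_D0 by blast
      then have "x \<in> S - Q" using in_Q ne by blast
      then show False using out_Q[of x y i] h(2)[of i y] xy e(2) by auto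
    qed
    then have ei: "\<psi> i e \<in> R - P" using e(2) by (simp add: \<psi>'_def)
    then have "i = 0" using \<psi>(4)[OF _ i eQ] \<psi>(2)[OF i eQ] by blast
    moreover have "s \<noteq> 2" using ei by (auto simp: R_def P_def)
    moreover have "?e0 \<in> new_pairs Q" using e0 pairs_D0 by blast
    ultimately have "\<psi>' i ?e0 \<in> own ` hub"
      using \<psi>(3) \<delta>(2) \<epsilon> by (simp add: \<psi>'_def)
    then show "\<exists>e\<in>all_pairs D\<^sub>0. \<psi>' i e \<in> own ` hub" using e0 by blast
  qed
  show thesis
  proof (rule that[of \<psi>'])
    show "inj_on (\<lambda>(i, e). \<psi>' i e) ({..<t - 1} \<times> new_pairs Q)"
      using \<psi>(1) by (rule inj_on_cong[THEN iffD1, rotated]) (auto simp: \<psi>'_def)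
  qed (use valid \<psi>(2) in \<open>auto simp: \<psi>'_def\<close>)
qed

subsection \<open>The colored graph without rainbow copies\<close>

lemma valid_values:
  assumes "valid \<psi>" "e \<in> new_pairs S"
  shows "\<psi> e \<in> R \<union> own ` hub"
  using assms(2)
proof (cases rule: new_pairsE)
  case 1
  then show ?thesis using assms(1) by (simp add: valid_def)
next
  case (2 x y)
  then show ?thesis using assms(1) by (simp add: valid_def)
qed

lemma valid_cong:
  assumes "\<And>e. e \<in> new_pairs S \<Longrightarrow> \<psi> e = \<psi>' e" "valid \<psi>"
  shows "valid \<psi>'"
proof -
  have 1: "\<psi>' e = \<psi> e" if "e \<in> all_pairs D\<^sub>0" for e
    using assms(1) pairs_D0_subset[of S] that by auto
  have 2: "\<psi>' {x, y} = \<psi> {x, y}" if "x \<in> S" "y \<in> D\<^sub>0" for x y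
    using assms(1) cross_pair_new[of x S y] that by auto
  have "inj_on (\<lambda>x. \<psi>' {x, y}) S \<longleftrightarrow> inj_on (\<lambda>x. \<psi> {x, y}) S" if "y \<in> D\<^sub>0" for y
    using 2 that by (intro inj_on_cong)
  then show ?thesis using assms(2) 1 2 assms(1) unfolding valid_def by simp
qed

text \<open>Extensional functions, so that only the values on the pairs of a block matter and the
  set is finite.\<close>

definition block_colors :: "(nat set \<Rightarrow> nat) set" where
  "block_colors = {\<psi> \<in> new_pairs S \<rightarrow>\<^sub>E R \<union> own ` hub. valid \<psi>}"

lemma finite_block_colors: "finite block_colors"
proof -
  have "finite (new_pairs S \<rightarrow>\<^sub>E R \<union> own ` hub)" by (intro finite_PiE) auto
  then show ?thesis by (rule finite_subset[rotated]) (auto simp: block_colors_def)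
qed

lemma restrict_in_block_colors:
  assumes "valid \<psi>"
  shows "restrict \<psi> (new_pairs S) \<in> block_colors"
proof -
  have "valid (restrict \<psi> (new_pairs S))"
    by (rule valid_cong[OF _ assms]) simp
  then show ?thesis
    using valid_values[OF assms] by (simp add: block_colors_def)
qed

text \<open>Block \<open>b\<close> is colored by \<open>\<phi> (b mod L)\<close>, so each admissible coloring occurs on \<open>t\<close> of the \<open>B\<close> blocks:
  \<open>t - 1\<close> distinct blocks with prescribed colorings exist even if a given block must be avoided.\<close>

definition L :: nat where "L = card block_colors"
definition \<phi> :: "nat \<Rightarrow> nat set \<Rightarrow> nat" where
  "\<phi> = (SOME f. bij_betw f {..<L} block_colors)"

lemma bij_\<phi>: "bij_betw \<phi> {..<L} block_colors"
proof -
  have "\<exists>f. bij_betw f {..<L} block_colors"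
    using ex_bij_betw_nat_finite[OF finite_block_colors] by (simp add: L_def lessThan_atLeast0)
  then show ?thesis unfolding \<phi>_def by (rule someI_ex)
qed

section \<open>Positions of the blocks, folding onto the template, and the colored graph\<close>

definition D :: "nat \<Rightarrow> nat set" where "D b = {s + b * p..<s + b * p + p}"
definition blk :: "nat \<Rightarrow> nat" where "blk v = (v - s) div p"
text \<open>Fixes \<open>S\<close> and folds every block onto the template \<open>D\<^sub>0\<close>;
  a coloring of the template is pulled back along it to each block.\<close>

definition \<tau> :: "nat \<Rightarrow> nat" where "\<tau> v = (if v < s then v else s + (v - s) mod p)"
definition B :: nat where "B = L * t"
definition k :: nat where "k = s + B * p"

text \<open>Blocks occupy the vertices from \<open>s\<close> up to \<open>k\<close>, above
  \<open>S\<close>. Hence the greater end of an edge of \<open>G n\<close> tells whether the edge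
  belongs to a block, and to which one.\<close>

definition c :: "nat set \<Rightarrow> nat" where
  "c e = (if s \<le> Max e \<and> Max e < k then \<phi> (blk (Max e) mod L) (\<tau> ` e) else own e)"

definition G :: "nat \<Rightarrow> nat graph" where
  "G n = Graph {..<n}
     (hub \<union> {{x, v} | x v. x \<in> S \<and> s \<le> v \<and> v < n} \<union> (\<Union>b<B. all_pairs (D b)))"

lemma D_D: "v \<in> D b \<Longrightarrow> blk v = b \<and> s \<le> v"
  using p2 unfolding D_def blk_def
  by (auto intro!: div_nat_eqI simp: algebra_simps)

lemma mem_D: "s \<le> v \<Longrightarrow> v \<in> D (blk v)"
proof -
  assume "s \<le> v"
  moreover have "(v - s) div p * p + (v - s) mod p = v - s" by (rule div_mult_mod_eq)
  moreover have "(v - s) mod p < p" using p2 by simp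
  ultimately show ?thesis unfolding D_def blk_def atLeastLessThan_iff by linarith
qed

lemma finite_D [simp]: "finite (D b)" and card_D [simp]: "card (D b) = p"
  by (simp_all add: D_def)

lemma D_less_k: "v \<in> D b \<Longrightarrow> b < B \<Longrightarrow> v < k"
proof -
  assume v: "v \<in> D b" "b < B"
  then have "Suc b * p \<le> B * p" by (intro mult_le_mono1) simp
  then show "v < k" using v by (simp add: D_def k_def)
qed

lemma blk_less_B: "s \<le> v \<Longrightarrow> v < k \<Longrightarrow> blk v < B"
  using p2 unfolding blk_def k_def by (simp add: less_mult_imp_div_less)

lemma S_D: "S \<inter> D b = {}"
  by (auto simp: S_def D_def)

lemma \<tau>_S: "x \<in> S \<Longrightarrow> \<tau> x = x"
  by (simp add: S_def \<tau>_def)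

lemma \<tau>_D: "v \<in> D b \<Longrightarrow> \<tau> v \<in> D\<^sub>0"
  using p2 by (auto simp: D_def \<tau>_def D\<^sub>0_def)

lemma inj_\<tau>: "inj_on \<tau> (S \<union> D b)"
proof (rule inj_onI)
  fix x y assume xy: "x \<in> S \<union> D b" "y \<in> S \<union> D b" "\<tau> x = \<tau> y"
  have *: "x = y" if "x \<in> D b" "y \<in> D b"
  proof -
    have "blk x = blk y" "s \<le> x" "s \<le> y" using that D_D by auto
    moreover from this have "(x - s) mod p = (y - s) mod p"
      using xy(3) by (simp add: \<tau>_def)
    ultimately have "x - s = y - s"
      unfolding blk_def by (metis div_mult_mod_eq)
    then show ?thesis using \<open>s \<le> x\<close> \<open>s \<le> y\<close> by simp
  qed
  show "x = y"
    using xy * \<tau>_S \<tau>_D S_D0 by (metis Un_iff disjoint_iff)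
qed

lemma \<tau>_image_D: "\<tau> ` D b = D\<^sub>0"
proof (rule card_subset_eq)
  have "inj_on \<tau> (D b)" by (rule inj_on_subset[OF inj_\<tau>[of b]]) simp
  then show "card (\<tau> ` D b) = card D\<^sub>0" by (simp add: card_image)
qed (use \<tau>_D in auto)

lemma \<tau>_image_S: "Q \<subseteq> S \<Longrightarrow> \<tau> ` Q = Q"
  using \<tau>_S by (force simp: subset_iff)

definition block_pairs :: "nat set \<Rightarrow> nat \<Rightarrow> nat set set" where
  "block_pairs Q b = all_pairs (Q \<union> D b) - all_pairs Q"

text \<open>Folding is injective on \<open>S \<union> D b\<close>, so taking images commutes with
  the set difference.\<close>

lemma \<tau>_block_pairs:
  assumes "Q \<subseteq> S"
  shows "(image \<tau>) ` block_pairs Q b = new_pairs Q"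
proof -
  have inj: "inj_on \<tau> (Q \<union> D b)" using assms by (intro inj_on_subset[OF inj_\<tau>]) auto
  have "inj_on (image \<tau>) (all_pairs (Q \<union> D b))"
    by (rule inj_onI) (metis (no_types, lifting) all_pairs_def inj inj_on_image_eq_iff mem_Collect_eq)
  then have "(image \<tau>) ` block_pairs Q b
      = (image \<tau>) ` all_pairs (Q \<union> D b) - (image \<tau>) ` all_pairs Q"
    unfolding block_pairs_def
    by (rule inj_on_image_set_diff) (auto simp: all_pairs_mono)
  also have "\<dots> = all_pairs (\<tau> ` (Q \<union> D b)) - all_pairs (\<tau> ` Q)"
    using inj by (simp add: all_pairs_image inj_on_Un)
  finally show ?thesis
    using assms by (simp add: image_Un \<tau>_image_S \<tau>_image_D new_pairs_def)
qed

lemma block_pairs_inj: "Q \<subseteq> S \<Longrightarrow> inj_on (image \<tau>) (block_pairs Q b)"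
proof (rule inj_onI)
  fix e e' assume *: "Q \<subseteq> S" "e \<in> block_pairs Q b" "e' \<in> block_pairs Q b" "\<tau> ` e = \<tau> ` e'"
  then have "e \<subseteq> S \<union> D b" "e' \<subseteq> S \<union> D b" by (auto simp: block_pairs_def all_pairs_def)
  then show "e = e'" using *(4) inj_on_image_eq_iff[OF inj_\<tau>] by blast
qed

lemma block_pairsE:
  assumes "e \<in> block_pairs Q b"
  obtains "e \<in> all_pairs (D b)" | x y where "e = {x, y}" "x \<in> Q" "y \<in> D b"
proof -
  obtain u v where uv: "e = {u, v}" "u \<in> Q \<union> D b" "v \<in> Q \<union> D b" "u \<noteq> v"
    and ne: "e \<notin> all_pairs Q"
    using assms unfolding block_pairs_def by (blast elim: all_pairsE)
  consider "u \<in> D b" "v \<in> D b" | "u \<in> Q" "v \<in> D b" | "v \<in> Q" "u \<in> D b"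
    using uv ne by auto
  then show thesis
  proof cases
    case 1
    then show thesis using uv that(1) by simp
  next
    case 2
    then show thesis using uv(1) that(2) by blast
  next
    case 3
    then show thesis using uv(1) that(2)[of v u] by blast
  qed
qed

lemma Max_block_pairs:
  assumes "e \<in> block_pairs Q b" "Q \<subseteq> S"
  shows "Max e \<in> D b"
  using assms(1)
proof (cases rule: block_pairsE)
  case 1
  then show ?thesis by (auto elim!: all_pairsE simp: max_def)
next
  case (2 x y)
  then have "x < y" using assms(2) D_D[of y b] by (auto simp: S_def)
  then show ?thesis using 2 by (simp add: max_def)
qed

lemma c_block:
  assumes "e \<in> block_pairs Q b" "Q \<subseteq> S" "b < B"
  shows "c e = \<phi> (b mod L) (\<tau> ` e)" "\<tau> ` e \<in> new_pairs Q"
proof -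
  have "Max e \<in> D b" by (rule Max_block_pairs[OF assms(1,2)])
  then show "c e = \<phi> (b mod L) (\<tau> ` e)"
    using D_D D_less_k assms(3) by (simp add: c_def)
  show "\<tau> ` e \<in> new_pairs Q" using \<tau>_block_pairs[OF assms(2)] assms(1) by blast
qed

lemma valid_block: "b < B \<Longrightarrow> valid (\<phi> (b mod L))"
proof -
  assume "b < B"
  then have "b mod L < L" by (cases "L = 0") (auto simp: B_def)
  then have "\<phi> (b mod L) \<in> block_colors" using bij_\<phi> by (auto simp: bij_betw_def)
  then show ?thesis by (simp add: block_colors_def)
qed

lemma new_pairs_mono: "Q \<subseteq> S \<Longrightarrow> new_pairs Q \<subseteq> new_pairs S"
proof
  fix e assume "Q \<subseteq> S" "e \<in> new_pairs Q"
  from this(2,1) show "e \<in> new_pairs S"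
    by (cases rule: new_pairsE) (use pairs_D0_subset[of S] cross_pair_new in auto)
qed

lemma c_hub: "e \<in> all_pairs S \<Longrightarrow> c e = own e"
  by (auto elim!: all_pairsE simp: c_def S_def)

lemma c_far: "k \<le> u \<Longrightarrow> x \<le> u \<Longrightarrow> c {x, u} = own {x, u}"
  by (simp add: c_def max_def)

lemma s_le_k: "s \<le> k"
  by (simp add: k_def)

lemma c_cross:
  assumes "s \<le> v" "v < k"
  shows "x \<in> S \<Longrightarrow> c {x, v} \<in> R" "inj_on (\<lambda>x. c {x, v}) S"
proof -
  define b where "b = blk v"
  have b: "b < B" "v \<in> D b" using assms by (simp_all add: b_def blk_less_B mem_D)
  have *: "c {x, v} = \<phi> (b mod L) {x, \<tau> v}" if "x \<in> S" for x
  proof -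
    have "{x, v} \<in> block_pairs S b" using that b(2) S_D by (auto simp: block_pairs_def)
    from c_block(1)[OF this _ b(1)] show ?thesis using \<tau>_S that by simp
  qed
  have V: "valid (\<phi> (b mod L))" using b(1) by (rule valid_block)
  have D: "\<tau> v \<in> D\<^sub>0" using b(2) by (rule \<tau>_D)
  show "c {x, v} \<in> R" if "x \<in> S" using V D that by (simp add: * valid_def)
  have "inj_on (\<lambda>x. \<phi> (b mod L) {x, \<tau> v}) S" using V D by (simp add: valid_def)
  then show "inj_on (\<lambda>x. c {x, v}) S"
    by (rule inj_on_cong[THEN iffD1, rotated]) (simp add: *)
qed

lemma edgesE:
  assumes "e \<in> edges (G n)"
  obtains "e \<in> hub" | x v where "e = {x, v}" "x \<in> S" "s \<le> v" "v < n"
    | b where "b < B" "e \<in> all_pairs (D b)"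
  using assms by (auto simp: G_def)

lemma hub_subset: "hub \<subseteq> all_pairs S"
  by (simp add: hub_def)

lemma all_pairs_D_block: "Q \<subseteq> S \<Longrightarrow> all_pairs (D b) \<subseteq> block_pairs Q b"
proof
  fix e assume *: "Q \<subseteq> S" "e \<in> all_pairs (D b)"
  then obtain x y where "e = {x, y}" "x \<in> D b" "y \<in> D b" "x \<noteq> y" by (blast elim: all_pairsE)
  then show "e \<in> block_pairs Q b" using S_D *(1) by (auto simp: block_pairs_def)
qed

text \<open>The color budget of a copy that stays inside \<open>S\<close> and the blocks.\<close>

lemma c_core:
  assumes "e \<in> edges (G n)" "e \<subseteq> {..<k}"
  shows "c e \<in> own ` hub \<union> R"
  using assms(1)
proof (cases rule: edgesE)
  case 1
  then show ?thesis using c_hub hub_subset by auto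
next
  case (2 x v)
  then show ?thesis using assms(2) c_cross(1)[of v x] by simp
next
  case (3 b)
  have "e \<in> block_pairs S b" using 3(2) all_pairs_D_block by blast
  from c_block[OF this _ 3(1)] have "c e = \<phi> (b mod L) (\<tau> ` e)" "\<tau> ` e \<in> new_pairs S" by auto
  then show ?thesis using valid_values[OF valid_block[OF 3(1)]] by auto
qed

lemma edges_G:
  assumes "n \<ge> k"
  shows "edges (G n) \<subseteq> all_pairs {..<n}"
proof
  fix e assume e: "e \<in> edges (G n)"
  have D: "D b \<subseteq> {..<n}" if "b < B" for b using D_less_k[OF _ that] assms by fastforce
  have S: "S \<subseteq> {..<n}" using assms s_le_k by (auto simp: S_def)
  from e show "e \<in> all_pairs {..<n}"
  proof (cases rule: edgesE)
    case 1
    then show ?thesis using hub_subset all_pairs_mono[OF S] by blast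
  next
    case (2 x v)
    then show ?thesis using S by (auto simp: S_def)
  next
    case (3 b)
    then show ?thesis using all_pairs_mono[OF D] by blast
  qed
qed

lemma far_edge: "{w, u} \<in> edges (G n) \<Longrightarrow> k \<le> u \<Longrightarrow> w \<in> S"
proof -
  assume "{w, u} \<in> edges (G n)" and u: "k \<le> u"
  then show "w \<in> S"
  proof (cases rule: edgesE)
    case 1
    then show ?thesis using u s_le_k hub_subset by (auto simp: S_def)
  next
    case (2 x v)
    then show ?thesis using u s_le_k by (auto simp: S_def doubleton_eq_iff)
  next
    case (3 b)
    then have "u < k" using D_less_k by auto
    then show ?thesis using u by simp
  qed
qed

lemma block_edge:
  assumes "{v, w} \<in> edges (G n)" "v \<notin> S" "w \<notin> S"
  shows "w \<in> D (blk v)"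
  using assms(1)
proof (cases rule: edgesE)
  case 1
  then show ?thesis using hub_subset assms by auto
next
  case (2 x v')
  then show ?thesis using assms by (auto simp: doubleton_eq_iff)
next
  case (3 b)
  then show ?thesis using D_D[of v b] by auto
qed

lemma hub_edge:
  assumes "e \<in> all_pairs S" "e \<in> edges (G n)"
  shows "e \<in> hub"
proof -
  obtain x y where e: "e = {x, y}" "x \<in> S" "y \<in> S" using assms(1) by (rule all_pairsE)
  from assms(2) show ?thesis
  proof (cases rule: edgesE)
    case (2 x' v)
    then show ?thesis using e by (auto simp: S_def doubleton_eq_iff)
  next
    case (3 b)
    then show ?thesis using e S_D by auto
  qed
qed

lemma no_rainbow_copy:
  assumes n: "n \<ge> k"
  shows "\<nexists>H. rainbow_copy (friendship_graph t p q) (G n) c H"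
proof
  assume "\<exists>H. rainbow_copy (friendship_graph t p q) (G n) c H"
  then obtain H where H: "rainbow_copy (friendship_graph t p q) (G n) c H" ..
  have t1: "t \<ge> 1" using t2 by simp
  obtain Q X where QX: "petals t p q Q X" "windmill t Q X \<subseteq> edges (G n)"
    and inj: "inj_on c (windmill t Q X)"
    by (rule rainbow_copyE[OF H t1])
  let ?W = "windmill t Q X"
  have clique: "all_pairs (Q \<union> X i) \<subseteq> edges (G n)" if "i < t" for i
    using QX(2) that by (auto simp: windmill_def)
  have card_W: "card (c ` ?W) = (q choose 2) + t * m"
    using card_image[OF inj] card_windmill[OF QX(1) t1] by (simp add: m_def)
  \<comment> \<open>Neighbours of an outer vertex \<open>u\<close> lie in \<open>S\<close>, and a
    clique of \<open>Suc s\<close> vertices through \<open>u\<close> must use all of them.\<close>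
  have far: "Q \<union> X i = insert u S" if i: "i < t" and u: "u \<in> Q \<union> X i" "k \<le> u" for i u
  proof (rule card_subset_eq)
    show "finite (insert u S)" by simp
    show "Q \<union> X i \<subseteq> insert u S"
    proof
      fix w assume w: "w \<in> Q \<union> X i"
      show "w \<in> insert u S"
      proof (cases "w = u")
        case False
        then have "{w, u} \<in> edges (G n)" using clique[OF i] w u(1) by auto
        then show ?thesis using far_edge u(2) by blast
      qed simp
    qed
    have "u \<notin> S" using u(2) s_le_k by (simp add: S_def)
    then show "card (Q \<union> X i) = card (insert u S)"
      using petals_card[OF QX(1) i] Suc_s by simp
  qed
  show False
  proof (cases "\<forall>i<t. Q \<union> X i \<subseteq> {..<k}")
    case True
    have "c ` ?W \<subseteq> own ` hub \<union> R"
    proof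
      fix y assume "y \<in> c ` ?W"
      then obtain e where e: "y = c e" "e \<in> ?W" by blast
      then have "e \<subseteq> {..<k}" using True by (auto simp: windmill_def all_pairs_def)
      then show "y \<in> own ` hub \<union> R" using c_core e QX(2) by blast
    qed
    then have "card (c ` ?W) \<le> card (own ` hub \<union> R)" by (intro card_mono) auto
    also have "\<dots> \<le> card hub + card R"
      by (meson add_le_mono1 card_Un_le card_image_le finite_hub le_trans)
    finally show False using card_W card_hub_R by simp
  next
    case False
    then obtain i u where i: "i < t" "u \<in> Q \<union> X i" "k \<le> u" by fastforce
    have Xi: "Q \<union> X i = insert u S" by (rule far[OF i])
    have "all_pairs S \<subseteq> all_pairs (Q \<union> X i)" unfolding Xi by (intro all_pairs_mono) auto
    then have SW: "all_pairs S \<subseteq> ?W" using i(1) by (auto simp: windmill_def)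
    \<comment> \<open>For \<open>s = 2\<close> the graph has no edge inside \<open>S\<close>, so an
      outer vertex can only be used when the hub is full.\<close>
    then have "all_pairs S \<subseteq> hub" using QX(2) hub_edge by blast
    moreover have "{0, 1} \<in> all_pairs S" using s2 by (simp add: S_def)
    ultimately have "hub \<noteq> {}" by blast
    then have hub: "hub = all_pairs S" "s \<noteq> 2"
      by (auto simp: hub_def split: if_splits)
    \<comment> \<open>Two cliques with outer vertices would share all of \<open>S\<close>, but they
      share only the \<open>q < s\<close> vertices of \<open>Q\<close>.\<close>
    have near: "Q \<union> X j \<subseteq> {..<k}" if j: "j < t" "j \<noteq> i" for j
    proof (rule ccontr)
      assume "\<not> Q \<union> X j \<subseteq> {..<k}"
      then obtain u' where u': "u' \<in> Q \<union> X j" "k \<le> u'" by fastforce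
      have "S \<subseteq> Q"
        using petals_Int[OF QX(1) j(1) i(1) j(2)] far[OF j(1) u'] Xi by blast
      then have "s \<le> q" using card_mono[of Q S] QX(1) by (auto simp: petals_def)
      then show False using sq by simp
    qed
    \<comment> \<open>Some petal other than \<open>i\<close>, available since
      \<open>t \<ge> 2\<close>. Its clique stays below \<open>k\<close>, so \<open>u\<close> is not
      in the kernel and \<open>Q \<subseteq> S\<close>.\<close>
    define j0 where "j0 = (if i = 0 then 1 else 0 :: nat)"
    have "j0 < t" "j0 \<noteq> i" using t2 by (auto simp: j0_def)
    then have "Q \<union> X j0 \<subseteq> {..<k}" by (rule near)
    then have "u \<notin> Q" using i(3) by auto
    moreover have "Q \<subseteq> insert u S" unfolding Xi[symmetric] by simp
    ultimately have QS: "Q \<subseteq> S" by (simp add: subset_insert)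
    \<comment> \<open>Clique \<open>i\<close> contains \<open>S\<close>, so the other petals avoid
      \<open>S\<close>; adjacency outside \<open>S\<close> stays within one block, which has just
      \<open>p\<close> vertices.\<close>
    have block: "\<exists>b<B. X j = D b" if j: "j < t" "j \<noteq> i" for j
    proof -
      have Xj: "finite (X j)" "card (X j) = p" "Q \<inter> X j = {}"
        using QX(1) j(1) by (auto simp: petals_def)
      then obtain y where y: "y \<in> X j" using p2 by fastforce
      have "X j \<inter> S = {}"
        using petals_Int[OF QX(1) j(1) i(1) j(2)] Xj(3) Xi by blast
      then have XS: "v \<notin> S" if "v \<in> X j" for v using that by blast
      have ys: "s \<le> y" "y < k" using XS[OF y] subsetD[OF near[OF j], of y] y by (simp_all add: S_def)
      have "X j \<subseteq> D (blk y)"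
      proof
        fix v assume v: "v \<in> X j"
        show "v \<in> D (blk y)"
        proof (cases "v = y")
          case True
          then show ?thesis using mem_D ys by simp
        next
          case False
          then have "{y, v} \<in> edges (G n)" using clique[OF j(1)] v y by auto
          then show ?thesis using block_edge XS v y by blast
        qed
      qed
      then have "X j = D (blk y)" using Xj by (intro card_subset_eq) auto
      then show ?thesis using blk_less_B ys by blast
    qed
    have colors: "c e \<in> own ` hub \<union> P" if j: "j < t" "j \<noteq> i" and e: "e \<in> all_pairs (Q \<union> X j)" for e j
    proof (cases "e \<in> all_pairs Q")
      case True
      then show ?thesis using all_pairs_mono[OF QS] c_hub hub(1) by blast
    next
      case False
      obtain b where b: "b < B" "X j = D b" using block[OF j] by blast
      have eb: "e \<in> block_pairs Q b" using e False b(2) by (simp add: block_pairs_def)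
      note ce = c_block[OF eb QS b(1)]
      have valid: "valid (\<phi> (b mod L))" using b(1) by (rule valid_block)
      \<comment> \<open>By \<open>valid\<close>, a reserved color comes with a hub color on a pair
        inside the block. That pair is in the copy, and so is the pair of \<open>S\<close> which
        owns the color.\<close>
      have "\<phi> (b mod L) (\<tau> ` e) \<notin> R - P"
      proof
        assume "\<phi> (b mod L) (\<tau> ` e) \<in> R - P"
        then obtain e' where e': "e' \<in> all_pairs D\<^sub>0" "\<phi> (b mod L) e' \<in> own ` hub"
          using valid ce(2) new_pairs_mono[OF QS] unfolding valid_def by blast
        have "inj_on \<tau> (D b)" by (rule inj_on_subset[OF inj_\<tau>[of b]]) simp
        from all_pairs_image[OF this]
        obtain f where f: "f \<in> all_pairs (D b)" "e' = \<tau> ` f"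
          using e'(1) by (auto simp: \<tau>_image_D)
        have "f \<in> block_pairs Q b" using f(1) all_pairs_D_block[OF QS] by blast
        from c_block(1)[OF this QS b(1)] obtain g where g: "g \<in> hub" "c f = own g"
          using e'(2) f(2) by auto
        then have "c f = c g" "g \<in> ?W" using c_hub hub(1) SW by auto
        moreover have "f \<in> ?W"
        proof -
          have "f \<in> all_pairs (Q \<union> X j)"
            using f(1) all_pairs_mono[of "X j" "Q \<union> X j"] b(2) by auto
          then show ?thesis using j(1) unfolding windmill_def by blast
        qed
        ultimately have "f = g" using inj by (auto dest: inj_onD)
        then have "f \<in> all_pairs S \<inter> all_pairs (D b)" using f(1) g(1) hub_subset by blast
        then show False by (auto simp: all_pairs_Int S_D elim: all_pairsE)
      qed
      then show ?thesis using valid_values[OF valid, of "\<tau> ` e"] new_pairs_mono[OF QS] ce by auto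
    qed
    \<comment> \<open>Clique \<open>i\<close> contributes hub colors and the \<open>s\<close> spokes
      at \<open>u\<close>; all other cliques only use colors of the hub and of
      \<open>P\<close>.\<close>
    have "c ` ?W \<subseteq> own ` hub \<union> P \<union> (\<lambda>x. own {x, u}) ` S"
    proof
      fix y assume "y \<in> c ` ?W"
      then obtain e j where e: "y = c e" "j < t" "e \<in> all_pairs (Q \<union> X j)"
        by (auto simp: windmill_def)
      show "y \<in> own ` hub \<union> P \<union> (\<lambda>x. own {x, u}) ` S"
      proof (cases "j = i")
        case False
        then show ?thesis using colors e by blast
      next
        case True
        show ?thesis
        proof (cases "e \<in> all_pairs S")
          case True
          then show ?thesis using c_hub hub(1) e(1) by auto
        next
          case False
          then obtain x where x: "e = {x, u}" "x \<in> S"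
            using e(3) unfolding \<open>j = i\<close> Xi by (auto elim!: all_pairsE simp: insert_commute)
          then have "x \<le> u" using i(3) s_le_k by (simp add: S_def)
          then show ?thesis using x e(1) c_far[OF i(3)] by auto
        qed
      qed
    qed
    then have "card (c ` ?W) \<le> card (own ` hub \<union> P \<union> (\<lambda>x. own {x, u}) ` S)"
      by (intro card_mono) auto
    also have "\<dots> \<le> card (own ` hub) + card P + card ((\<lambda>x. own {x, u}) ` S)"
      by (meson add_le_mono1 card_Un_le le_trans)
    also have "\<dots> \<le> card hub + card P + s"
      using card_image_le[of hub own] card_image_le[of S "\<lambda>x. own {x, u}"] by simp
    finally show False using card_W card_hub_P[OF hub(2)] by simp
  qed
qed

subsection \<open>New edges create rainbow copies\<close>

lemma inj_on_own: "(\<And>e. e \<in> X \<Longrightarrow> c e = own e \<and> finite e) \<Longrightarrow> inj_on c X"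
  by (rule inj_onI) (simp add: own_inject)

text \<open>Own colors are distinct and even. The spokes at \<open>x\<close> have own colors if
  \<open>k \<le> x\<close>, and otherwise distinct colors of \<open>R\<close>, which are
  odd.\<close>

lemma spokes_injective:
  assumes u: "k \<le> u" and x: "s \<le> x" "x \<noteq> u"
  shows "inj_on c (all_pairs ({u, x} \<union> S) - {{u, x}})"
proof -
  let ?X = "(\<lambda>y. {y, x}) ` S"
  let ?O = "all_pairs (insert u S)"
  have sub: "all_pairs ({u, x} \<union> S) - {{u, x}} \<subseteq> ?O \<union> ?X"
  proof
    fix e assume e: "e \<in> all_pairs ({u, x} \<union> S) - {{u, x}}"
    then obtain a b where ab: "e = {a, b}" "a \<in> {u, x} \<union> S" "b \<in> {u, x} \<union> S" "a \<noteq> b"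
      by (blast elim: all_pairsE)
    then consider "a = x" "b \<in> S" | "b = x" "a \<in> S" | "a \<in> insert u S" "b \<in> insert u S"
      using e by (auto simp: insert_commute)
    then show "e \<in> ?O \<union> ?X" using ab by cases auto
  qed
  have O: "c e = own e" "finite e" if "e \<in> ?O" for e
  proof -
    obtain a b where ab: "e = {a, b}" "a \<in> insert u S" "b \<in> insert u S" "a \<noteq> b"
      using \<open>e \<in> ?O\<close> by (rule all_pairsE)
    have le: "y \<le> u" if "y \<in> insert u S" for y
      using that u s_le_k by (auto simp: S_def)
    show "finite e" using ab by simp
    show "c e = own e"
    proof (cases "u \<in> e")
      case True
      then obtain y where "e = {y, u}" "y \<in> insert u S" using ab by (metis empty_iff insertE insert_commute)
      then show ?thesis using c_far[OF u le] by simp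
    next
      case False
      then show ?thesis using ab by (intro c_hub) auto
    qed
  qed
  have "inj_on c (?O \<union> ?X)"
  proof (cases "k \<le> x")
    case True
    show ?thesis
    proof (rule inj_on_own)
      fix e assume "e \<in> ?O \<union> ?X"
      then show "c e = own e \<and> finite e"
      proof
        assume "e \<in> ?X"
        then obtain y where "e = {y, x}" "y \<le> x" using x(1) by (auto simp: S_def)
        then show ?thesis using c_far[OF True] by simp
      qed (use O in simp)
    qed
  next
    case False
    then have X: "c {y, x} \<in> R" "inj_on (\<lambda>y. c {y, x}) S" if "y \<in> S" for y
      using c_cross[of x] x(1) that by auto
    have "inj_on c ?O" using O by (intro inj_on_own) simp
    moreover have "inj_on c ?X"
      using c_cross(2)[of x] x(1) False by (auto simp: inj_on_def)
    moreover have "c ` ?O \<inter> c ` ?X = {}"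
    proof -
      have "y \<notin> R" if "y \<in> c ` ?O" for y using that O(1) by auto
      moreover have "y \<in> R" if "y \<in> c ` ?X" for y using that X(1) by auto
      ultimately show ?thesis by blast
    qed
    ultimately show ?thesis unfolding inj_on_Un by blast
  qed
  then show ?thesis using sub by (rule inj_on_subset)
qed

text \<open>The vertex \<open>a\<close> is dropped from the clique through the new edge, and the color of
  \<open>{a, b}\<close> is then reused inside a block.\<close>

lemma dropped_vertex:
  assumes u: "k \<le> u" and x: "s \<le> x" "x \<noteq> u"
  obtains a b where "a \<in> S" "b \<in> S" "a \<noteq> b" "s \<noteq> 2 \<Longrightarrow> \<alpha> \<noteq> own {a, b}"
    "\<And>e. e \<in> all_pairs ({u, x} \<union> (S - {a})) \<Longrightarrow> e \<noteq> {u, x} \<Longrightarrow> c e \<noteq> \<alpha>"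
proof -
  let ?E = "all_pairs ({u, x} \<union> S) - {{u, x}}"
  have SE: "all_pairs S \<subseteq> ?E"
    using u x s_le_k all_pairs_mono[of S "{u, x} \<union> S"] by (auto simp: S_def)
  have sub: "e \<in> ?E" if "e \<in> all_pairs ({u, x} \<union> (S - {a}))" "e \<noteq> {u, x}" for e a
    using that all_pairs_mono[of "{u, x} \<union> (S - {a})" "{u, x} \<union> S"] by blast
  show thesis
  proof (cases "\<alpha> \<in> c ` ?E")
    case False
    \<comment> \<open>If \<alpha> occurs on none of these edges, any two vertices of
      \<open>S\<close> will do.\<close>
    have *: "0 \<in> S" "1 \<in> S" "(0::nat) \<noteq> 1" using s2 by (auto simp: S_def)
    then have "{0, 1} \<in> all_pairs S" by simp
    then have "\<alpha> \<noteq> own {0, 1}" using False SE c_hub by (metis image_eqI subsetD)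
    then show thesis using that[OF *] sub False by blast
  next
    case True
    then obtain f where f: "\<alpha> = c f" "f \<in> ?E" by blast
    \<comment> \<open>The only edge \<open>f\<close> of color \<alpha> is not \<open>{u, x}\<close>,
      so it has an end in \<open>S\<close>; dropping that end removes \<alpha> from the
      clique.\<close>
    obtain a z where az: "f = {a, z}" "a \<in> S" "a \<noteq> z"
    proof -
      obtain a z where "f = {a, z}" "a \<in> {u, x} \<union> S" "z \<in> {u, x} \<union> S" "a \<noteq> z"
        using f(2) by (blast elim: all_pairsE)
      then have "a \<in> S \<or> z \<in> S" using f(2) by (auto simp: insert_commute)
      then show thesis using that \<open>f = {a, z}\<close> \<open>a \<noteq> z\<close> by (metis insert_commute)
    qed
    \<comment> \<open>With \<open>b \<noteq> z\<close> the color of \<open>{a, b}\<close> differs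
      from \<alpha>. This takes a third vertex of \<open>S\<close>, hence the exception for
      \<open>s = 2\<close>.\<close>
    have "\<exists>b\<in>S - {a}. s \<noteq> 2 \<longrightarrow> b \<noteq> z"
    proof -
      have "card (S - {a}) = s - 1" using az(2) by simp
      moreover have "card (S - {a} - {z}) \<ge> card (S - {a}) - 1"
        by (simp add: card_Diff_singleton_if)
      ultimately have "S - {a} \<noteq> {}" "s \<noteq> 2 \<Longrightarrow> S - {a} - {z} \<noteq> {}"
        using s2 by (force, force)
      then show ?thesis by (cases "s = 2") auto
    qed
    then obtain b where b: "b \<in> S" "b \<noteq> a" "s \<noteq> 2 \<Longrightarrow> b \<noteq> z" by blast
    have inj: "inj_on c ?E" by (rule spokes_injective[OF u x])
    show thesis
    proof (rule that[of a b])
      show "\<alpha> \<noteq> own {a, b}" if "s \<noteq> 2"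
      proof
        assume "\<alpha> = own {a, b}"
        moreover have ab: "{a, b} \<in> all_pairs S" using az b by auto
        ultimately have "c f = c {a, b}" using f(1) c_hub by simp
        then have "f = {a, b}" using inj_onD[OF inj _ f(2)] SE ab by blast
        then show False using az b that by (auto simp: doubleton_eq_iff)
      qed
      show "c e \<noteq> \<alpha>" if e: "e \<in> all_pairs ({u, x} \<union> (S - {a}))" "e \<noteq> {u, x}" for e
      proof
        assume "c e = \<alpha>"
        then have "e = f" using inj_onD[OF inj _ sub[OF e] f(2)] f(1) by simp
        moreover have "a \<notin> {u, x}" using az(2) u x s_le_k by (auto simp: S_def)
        ultimately show False using e(1) az(1) by (auto simp: all_pairs_def)
      qed
    qed (use az b in auto)
  qed
qed

lemma blocks_with_colorings:
  assumes "\<And>i. i < t - 1 \<Longrightarrow> valid (\<psi> i)"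
  obtains b where "\<And>i. i < t - 1 \<Longrightarrow> b i < B" "inj_on b {..<t - 1}" "\<And>i. b i \<noteq> b\<^sub>0"
    "\<And>i e. i < t - 1 \<Longrightarrow> e \<in> new_pairs S \<Longrightarrow> \<phi> (b i mod L) e = \<psi> i e"
proof -
  have "\<exists>l<L. \<phi> l = restrict (\<psi> i) (new_pairs S)" if "i < t - 1" for i
    using bij_\<phi> restrict_in_block_colors[OF assms[OF that]] unfolding bij_betw_def by (metis imageE lessThan_iff)
  then obtain l where l: "\<And>i. i < t - 1 \<Longrightarrow> l i < L"
    "\<And>i. i < t - 1 \<Longrightarrow> \<phi> (l i) = restrict (\<psi> i) (new_pairs S)" by metis
  have "0 < t - 1" using t2 by simp
  then have L: "L > 0" using l(1) by fastforce
  \<comment> \<open>Layer \<open>j i\<close> skips the layer of \<open>b\<^sub>0\<close>; of the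
    \<open>t\<close> layers, \<open>t - 1\<close> remain.\<close>
  define j where "j = (\<lambda>i. if i < b\<^sub>0 div L then i else Suc i)"
  \<comment> \<open>The minimum keeps the argument of \<open>l\<close> in range, so that the
    quotient and remainder below hold for every \<open>i\<close>.\<close>
  define b where "b = (\<lambda>i. l (min i (t - 2)) + L * j i)"
  have l': "l (min i (t - 2)) < L" for i using l(1) t2 by simp
  have div: "b i div L = j i" and mod: "b i mod L = l (min i (t - 2))" for i
    using l' L by (simp_all add: b_def)
  have min: "min i (t - 2) = i" if "i < t - 1" for i using that by simp
  show thesis
  proof (rule that[of b])
    show "b i < B" if "i < t - 1" for i
    proof -
      have "Suc (j i) \<le> t" using that by (auto simp: j_def)
      then have "L * Suc (j i) \<le> L * t" by (rule mult_le_mono2)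
      then show ?thesis using l'[of i] by (simp add: b_def B_def)
    qed
    have "inj j" by (auto simp: inj_def j_def split: if_splits)
    then show "inj_on b {..<t - 1}" using div by (metis injD inj_onI)
    show "b i \<noteq> b\<^sub>0" for i using div[of i] by (auto simp: j_def split: if_splits)
    show "\<phi> (b i mod L) e = \<psi> i e" if "i < t - 1" "e \<in> new_pairs S" for i e
      using that l(2) by (simp add: mod min)
  qed
qed

text \<open>For \<open>s \<noteq> 2\<close> at least \<open>(t - 1) * m - 1\<close> colors of
  \<open>R\<close> are left, and the freed hub color \<epsilon> supplies the missing one. For
  \<open>s = 2\<close> at least \<open>3 * t - 3\<close> are left, which is enough.\<close>

lemma card_available:
  assumes "A = R - {\<alpha>} - C" "finite C" "card C \<le> s - 1" "\<epsilon> \<notin> R"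
  shows "(t - 1) * m \<le> card (if s = 2 then A else insert \<epsilon> A)"
proof -
  have "card (R - {\<alpha>}) - card C \<le> card A"
    unfolding assms(1) by (rule diff_card_le_card_Diff[OF assms(2)])
  moreover have "card R - 1 \<le> card (R - {\<alpha>})" by (simp add: card_Diff_singleton_if)
  ultimately have A: "card R - 1 - (s - 1) \<le> card A" using assms(3) by linarith
  have "card (insert \<epsilon> A) = Suc (card A)" using assms by simp
  moreover define M where "M = (t - 1) * m"
  moreover have "M \<ge> 1" using m_le m_gt unfolding M_def by linarith
  moreover have "s = 2 \<Longrightarrow> M = 3 * t - 3" using m_s2 t2 by (simp add: M_def algebra_simps)
  moreover have "card R = (if s = 2 then 3 * t - 1 else M - 1 + s)"
    by (simp only: card_R M_def)
  ultimately show ?thesis using A s2 unfolding M_def[symmetric] by auto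
qed

lemma spoke_edge: "w \<in> S \<Longrightarrow> s \<le> v \<Longrightarrow> v < n \<Longrightarrow> {w, v} \<in> edges (G n)"
  unfolding G_def graph.sel by blast

lemma hub_edges: "hub \<subseteq> edges (G n)"
  by (auto simp: G_def)

lemma block_edges: "b < B \<Longrightarrow> all_pairs (D b) \<subseteq> edges (G n)"
  by (auto simp: G_def)

text \<open>One clique consists of the new edge and \<open>S\<close> without a vertex
  \<open>a\<close>; the other petals are blocks whose colorings avoid every color of this
  clique.\<close>

lemma rainbow_copy_through_edge:
  assumes n: "k \<le> n" and u: "k \<le> u" "u < n" and x: "s \<le> x" "x < n" "x \<noteq> u"
  obtains H where
    "rainbow_copy (friendship_graph t p q) (add_edge (G n) {u, x}) (c({u, x} := \<alpha>)) H"
    "{u, x} \<in> edges H"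
proof -
  have t1: "t \<ge> 1" using t2 by simp
  have uS: "u \<notin> S" and xS: "x \<notin> S" using u x s_le_k by (auto simp: S_def)
  obtain a b where ab: "a \<in> S" "b \<in> S" "a \<noteq> b" "s \<noteq> 2 \<Longrightarrow> \<alpha> \<noteq> own {a, b}"
    and avoid: "\<And>e. e \<in> all_pairs ({u, x} \<union> (S - {a})) \<Longrightarrow> e \<noteq> {u, x} \<Longrightarrow> c e \<noteq> \<alpha>"
    using dropped_vertex[OF u(1) x(1,3)] by metis
  define T where "T = S - {a}"
  have T: "finite T" "card T = s - 1" "T \<subseteq> S" using ab(1) by (auto simp: T_def)
  have "q \<le> card T" using T(2) sq by simp
  then obtain Q where Q: "Q \<subseteq> T" "card Q = q" "finite Q"
    by (rule obtain_subset_with_card_n)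
  have QS: "Q \<subseteq> S" using Q T by blast
  \<comment> \<open>Colors of \<open>R\<close> that the new clique does not use: neither the color
    of the new edge nor those of the spokes at \<open>x\<close>, which come from \<open>R\<close> if
    \<open>x\<close> is in a block.\<close>
  define A where "A = R - {\<alpha>} - (\<lambda>y. c {y, x}) ` T"
  let ?\<epsilon> = "own {a, b}"
  have \<epsilon>: "?\<epsilon> \<in> own ` hub" if "s \<noteq> 2" using that ab by (auto simp: hub_def)
  have cA: "(t - 1) * m \<le> card (if s = 2 then A else insert ?\<epsilon> A)"
    using T card_image_le[OF T(1), of "\<lambda>y. c {y, x}"]
    by (intro card_available[of A \<alpha> "(\<lambda>y. c {y, x}) ` T"]) (auto simp: A_def)
  obtain \<psi> where valid: "\<And>i. i < t - 1 \<Longrightarrow> valid (\<psi> i)"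
    and \<psi>_inj: "inj_on (\<lambda>(i, e). \<psi> i e) ({..<t - 1} \<times> new_pairs Q)"
    and \<psi>_A: "\<And>i e. i < t - 1 \<Longrightarrow> e \<in> new_pairs Q \<Longrightarrow> \<psi> i e \<in> (if s = 2 then A else insert ?\<epsilon> A)"
    using block_colorings[OF QS Q(2) _ cA \<epsilon>] A_def by blast
  \<comment> \<open>If \<open>x\<close> lies in a block, that block cannot serve as a petal.\<close>
  obtain d where d: "\<And>i. i < t - 1 \<Longrightarrow> d i < B" "inj_on d {..<t - 1}" "\<And>i. d i \<noteq> blk x"
    "\<And>i e. i < t - 1 \<Longrightarrow> e \<in> new_pairs S \<Longrightarrow> \<phi> (d i mod L) e = \<psi> i e"
    by (rule blocks_with_colorings[of \<psi> "blk x"]) (use valid in auto)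
  \<comment> \<open>The petal through the new edge comes last; its size is
    \<open>2 + (s - 1 - q) = p\<close>.\<close>
  define X where "X = (\<lambda>i. if i = t - 1 then {u, x} \<union> (T - Q) else D (d i))"
  have uD: "u \<notin> D (d i)" if "i < t - 1" for i
    using D_less_k[OF _ d(1)[OF that]] u(1) by fastforce
  have xD: "x \<notin> D (d i)" for i using D_D d(3) by metis
  have DD: "D (d i) \<inter> D (d j) = {}" if "i < t - 1" "j < t - 1" "i \<noteq> j" for i j
  proof -
    have "d i \<noteq> d j" using d(2) that by (auto dest: inj_onD)
    then show ?thesis by (metis D_D disjoint_iff)
  qed
  have petals: "petals t p q Q X"
    unfolding petals_def
  proof (intro conjI allI impI)
    fix i assume "i < t"
    show "finite (X i)" using T by (simp add: X_def)
    have "card ({u, x} \<union> (T - Q)) = 2 + card (T - Q)"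
      using uS xS x(3) T by (subst card_Un_disjoint) auto
    also have "\<dots> = p"
      using Q T p2 by (simp add: card_Diff_subset s_def)
    finally show "card (X i) = p" by (simp add: X_def)
    show "Q \<inter> X i = {}" using uS xS QS S_D by (auto simp: X_def)
  next
    fix i j assume ij: "i < t" "j < t" "i \<noteq> j"
    have *: "({u, x} \<union> (T - Q)) \<inter> D (d i) = {}" if "i < t - 1" for i
      using uD[OF that] xD T(3) S_D[of "d i"] by auto
    consider "i = t - 1" "j < t - 1" | "j = t - 1" "i < t - 1" | "i < t - 1" "j < t - 1"
      using ij by linarith
    then show "X i \<inter> X j = {}"
    proof cases
      case 1
      then show ?thesis using *[OF 1(2)] by (simp add: X_def)
    next
      case 2
      then show ?thesis using *[OF 2(2)] by (simp add: X_def Int_commute)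
    next
      case 3
      then show ?thesis using DD[OF 3 ij(3)] by (simp add: X_def)
    qed
  qed (use Q in auto)
  let ?W0 = "all_pairs ({u, x} \<union> T)"
  define N where "N = (\<lambda>i. block_pairs Q (d i))"
  have QX: "Q \<union> X (t - 1) = {u, x} \<union> T" using Q by (auto simp: X_def)
  have W: "windmill t Q X = ?W0 \<union> (\<Union>i<t - 1. N i)"
  proof -
    have "all_pairs Q \<subseteq> ?W0" using Q by (intro all_pairs_mono) auto
    moreover have "{..<t} = insert (t - 1) {..<t - 1}" using t1 by auto
    ultimately show ?thesis
      using QX unfolding windmill_def by (auto simp: N_def block_pairs_def X_def)
  qed
  have ux: "{u, x} \<in> ?W0" using x(3) by simp
  have W0_edges: "?W0 \<subseteq> insert {u, x} (edges (G n))"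
  proof
    fix e assume "e \<in> ?W0"
    then obtain y z where yz: "e = {y, z}" "y \<in> {u, x} \<union> T" "z \<in> {u, x} \<union> T" "y \<noteq> z"
      by (rule all_pairsE)
    have spoke: "{w, v} \<in> edges (G n)" if "w \<in> T" "v \<in> {u, x}" for v w
      using that T(3) u x s_le_k by (intro spoke_edge) auto
    have "{y, z} \<in> edges (G n)" if "y \<in> T" "z \<in> T"
    proof -
      \<comment> \<open>For \<open>s = 2\<close> the missing edge inside \<open>S\<close> does no
        harm, since \<open>T\<close> is a single vertex.\<close>
      have "s \<noteq> 2"
      proof
        assume "s = 2"
        then have "card T = 1" using T(2) by simp
        then show False using that yz(4) by (auto simp: card_1_singleton_iff)
      qed
      then have "{y, z} \<in> hub" using that T(3) yz(4) by (auto simp: hub_def)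
      then show ?thesis using hub_edges by blast
    qed
    then show "e \<in> insert {u, x} (edges (G n))"
      using yz spoke[of y z] spoke[of z y] by (auto simp: insert_commute)
  qed
  have N_edges: "N i \<subseteq> edges (G n)" if i: "i < t - 1" for i
  proof
    fix e assume "e \<in> N i"
    then show "e \<in> edges (G n)" unfolding N_def
    proof (cases rule: block_pairsE)
      case 1
      then show ?thesis using block_edges[OF d(1)[OF i]] by blast
    next
      case (2 y z)
      have "s \<le> z" "z < n" using D_D[OF 2(3)] D_less_k[OF 2(3) d(1)[OF i]] n by auto
      then show ?thesis using 2 QS by (auto intro: spoke_edge)
    qed
  qed
  have N_color: "c e = \<psi> i (\<tau> ` e)" "\<tau> ` e \<in> new_pairs Q" if "i < t - 1" "e \<in> N i" for i e
  proof -
    have eN: "e \<in> block_pairs Q (d i)" using that(2) by (simp add: N_def)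
    show *: "\<tau> ` e \<in> new_pairs Q" by (rule c_block(2)[OF eN QS d(1)[OF that(1)]])
    then have "\<tau> ` e \<in> new_pairs S" using new_pairs_mono[OF QS] by blast
    then show "c e = \<psi> i (\<tau> ` e)"
      using c_block(1)[OF eN QS d(1)[OF that(1)]] d(4)[OF that(1)] by simp
  qed
  have N_new: "e \<noteq> {u, x}" if "i < t - 1" "e \<in> N i" for i e
  proof
    assume "e = {u, x}"
    then have "Max e \<in> {u, x}" by (intro subsetD[OF _ Max_in]) auto
    moreover have "Max e \<in> D (d i)"
      using that(2) QS unfolding N_def by (rule Max_block_pairs)
    ultimately show False using uD[OF that(1)] xD by auto
  qed
  let ?c = "c({u, x} := \<alpha>)"
  have W0_inj: "inj_on ?c ?W0"
  proof -
    have "?W0 \<subseteq> all_pairs ({u, x} \<union> S)" using T(3) by (intro all_pairs_mono) auto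
    then have "inj_on c (?W0 - {{u, x}})"
      by (intro inj_on_subset[OF spokes_injective[OF u(1) x(1,3)]]) auto
    then have "inj_on ?c (?W0 - {{u, x}})"
      by (rule inj_on_cong[THEN iffD1, rotated]) auto
    moreover have "?c {u, x} \<notin> ?c ` (?W0 - {{u, x}})"
      using avoid by (auto simp: T_def)
    ultimately have "inj_on ?c (insert {u, x} (?W0 - {{u, x}}))"
      unfolding inj_on_insert Diff_idemp by (rule conjI)
    then show ?thesis unfolding insert_Diff[OF ux] .
  qed
  have N_inj: "inj_on ?c (\<Union>i<t - 1. N i)"
  proof (rule inj_onI)
    fix e e' assume "e \<in> (\<Union>i<t - 1. N i)" "e' \<in> (\<Union>i<t - 1. N i)" and eq: "?c e = ?c e'"
    then obtain i j where i: "i < t - 1" "e \<in> N i" and j: "j < t - 1" "e' \<in> N j" by blast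
    have "\<psi> i (\<tau> ` e) = \<psi> j (\<tau> ` e')"
      using eq N_color i j N_new[OF i] N_new[OF j] by simp
    then have "i = j" "\<tau> ` e = \<tau> ` e'"
      using inj_onD[OF \<psi>_inj, of "(i, \<tau> ` e)" "(j, \<tau> ` e')"] i j N_color by auto
    then show "e = e'" using block_pairs_inj[OF QS] i j by (auto simp: N_def dest: inj_onD)
  qed
  have sep: "?c e \<noteq> ?c f" if e: "e \<in> ?W0" and f: "f \<in> N i" "i < t - 1" for e f i
  proof -
    have cf: "?c f \<in> (if s = 2 then A else insert ?\<epsilon> A)"
      using N_color[OF f(2,1)] N_new[OF f(2,1)] \<psi>_A[OF f(2)] by simp
    have own_e: "own e \<notin> (if s = 2 then A else insert ?\<epsilon> A)"
    proof -
      have "finite e" "a \<notin> e" using e uS xS ab(1) by (auto simp: T_def elim!: all_pairsE)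
      then have "own e \<noteq> ?\<epsilon>" using own_inject[of e "{a, b}"] by auto
      then show ?thesis by (auto simp: A_def)
    qed
    have "?c e \<notin> (if s = 2 then A else insert ?\<epsilon> A)"
    proof (cases "e = {u, x}")
      case True
      then show ?thesis using ab(4) by (auto simp: A_def)
    next
      case False
      obtain y z where yz: "e = {y, z}" "y \<in> {u, x} \<union> T" "z \<in> {u, x} \<union> T" "y \<noteq> z"
        using e by (rule all_pairsE)
      then consider "y \<in> T" "z \<in> T" | w where "w \<in> T" "e = {w, u}" | w where "w \<in> T" "e = {w, x}"
        using False by (auto simp: insert_commute)
      then show ?thesis
      proof cases
        case 1
        then have "e \<in> all_pairs S" using yz T by auto
        then show ?thesis using c_hub own_e False by simp
      next
        case (2 w)
        then have "w \<le> u" using T(3) u(1) s_le_k by (auto simp: S_def)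
        then show ?thesis using 2 c_far[OF u(1)] own_e False by simp
      next
        case (3 w)
        then have w: "w \<in> S" "w \<le> x" using T(3) x(1) by (auto simp: S_def)
        show ?thesis
        proof (cases "k \<le> x")
          case True
          then show ?thesis using 3 c_far w own_e False by simp
        next
          case False
          then have "c e \<in> R" "c e \<in> (\<lambda>y. c {y, x}) ` T" using c_cross(1)[of x w] w x(1) 3 by auto
          then have "c e \<notin> A" "c e \<noteq> ?\<epsilon>" using own_notin_R[of "{a, b}"]
            unfolding A_def by (blast, metis)
          then show ?thesis using \<open>e \<noteq> {u, x}\<close> by simp
        qed
      qed
    qed
    then show ?thesis using cf by metis
  qed
  have "inj_on ?c (windmill t Q X)"
    unfolding W inj_on_Un using W0_inj N_inj sep by blast
  moreover have "windmill t Q X \<subseteq> edges (add_edge (G n) {u, x})"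
    unfolding W using W0_edges N_edges by (auto simp: add_edge_def)
  moreover have "Q \<union> (\<Union>i<t. X i) \<subseteq> verts (add_edge (G n) {u, x})"
  proof -
    have "D (d i) \<subseteq> {..<n}" if "i < t - 1" for i using D_less_k d(1)[OF that] n by fastforce
    moreover have S: "S \<subseteq> {..<n}" using n s_le_k by (auto simp: S_def)
    ultimately have "X i \<subseteq> {..<n}" if "i < t" for i
      using that T(3) u x by (cases "i = t - 1") (auto simp: X_def)
    then have "Q \<union> (\<Union>i<t. X i) \<subseteq> {..<n}" using QS S by blast
    then show ?thesis by (simp add: add_edge_def G_def)
  qed
  ultimately obtain H where
    "rainbow_copy (friendship_graph t p q) (add_edge (G n) {u, x}) ?c H" "edges H = windmill t Q X"
    using rainbow_copyI[OF petals t1] by metis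
  then show thesis using that ux W by auto
qed

section \<open>Saturated graphs with few edges and the bounds on \<open>rsat\<close>\<close>

lemma saturated_graph_exists:
  assumes n: "n \<ge> k"
  obtains H :: "nat graph" and c' where "simple_graph H" "card (verts H) = n"
    "rainbow_saturated (friendship_graph t p q) H c'"
    "card (edges H) \<le> card (all_pairs {..<k}) + s * n"
proof -
  let ?W = "all_pairs {..<k}"
  have V: "verts (G n) = {..<n}" by (simp add: G_def)
  have "\<exists>H. rainbow_copy (friendship_graph t p q) (add_edge (G n) e) (c(e := \<alpha>)) H \<and> e \<in> edges H"
    if e: "e \<in> nonedges (G n)" "e \<notin> ?W" for e \<alpha>
  proof -
    obtain v w where vw: "e = {v, w}" "v < n" "w < n" "v \<noteq> w"
      using e(1) by (auto simp: nonedges_def V elim!: all_pairsE)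
    then have "k \<le> v \<or> k \<le> w" using e(2) by auto
    then obtain u x where ux: "e = {u, x}" "u < n" "x < n" "x \<noteq> u" "k \<le> u"
      using vw by (metis insert_commute)
    have "s \<le> x"
    proof (rule ccontr)
      assume "\<not> s \<le> x"
      then have "{x, u} \<in> edges (G n)" using ux s_le_k by (intro spoke_edge) (auto simp: S_def)
      then show False using e(1) ux(1) by (simp add: nonedges_def insert_commute)
    qed
    then show ?thesis using rainbow_copy_through_edge[OF n ux(5,2) _ ux(3,4)] ux(1) by metis
  qed
  moreover have "?W \<subseteq> all_pairs (verts (G n))" unfolding V using n by (intro all_pairs_mono) auto
  ultimately obtain H c' where H: "verts H = verts (G n)" "edges H \<subseteq> edges (G n) \<union> ?W"
    "simple_graph H" "rainbow_saturated (friendship_graph t p q) H c'"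
    using saturated_extension[of "G n" ?W "friendship_graph t p q" c] no_rainbow_copy[OF n]
      edges_G[OF n] by (metis V finite_all_pairs finite_lessThan)
  have "edges (G n) \<subseteq> ?W \<union> (\<lambda>(x, v). {x, v}) ` (S \<times> {..<n})"
  proof
    fix e assume "e \<in> edges (G n)"
    then show "e \<in> ?W \<union> (\<lambda>(x, v). {x, v}) ` (S \<times> {..<n})"
    proof (cases rule: edgesE)
      case 1
      then show ?thesis using hub_subset all_pairs_mono[of S "{..<k}"] s_le_k by (auto simp: S_def)
    next
      case (3 b)
      then show ?thesis using all_pairs_mono[of "D b" "{..<k}"] D_less_k by auto
    qed auto
  qed
  then have "card (edges H) \<le> card (?W \<union> (\<lambda>(x, v). {x, v}) ` (S \<times> {..<n}))"
    using H(2) by (intro card_mono) auto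
  also have "\<dots> \<le> card ?W + card ((\<lambda>(x, v). {x, v}) ` (S \<times> {..<n}))"
    by (rule card_Un_le)
  also have "\<dots> \<le> card ?W + card (S \<times> {..<n})"
    by (intro add_left_mono card_image_le) simp
  finally have "card (edges H) \<le> card ?W + s * n" by (simp add: card_cartesian_product)
  then show thesis using that H V by simp
qed

lemma rsat_bounds:
  assumes n: "n \<ge> k"
  shows "rsat n (friendship_graph t p q) \<le> card (all_pairs {..<k}) + s * n"
    and "s * (n - 2 * s) \<le> rsat n (friendship_graph t p q)"
proof -
  let ?F = "friendship_graph t p q"
  let ?M = "{card (edges G) | G :: nat graph.
     simple_graph G \<and> card (verts G) = n \<and> (\<exists>c. rainbow_saturated ?F G c)}"
  obtain H :: "nat graph" and c' where H: "simple_graph H" "card (verts H) = n" "rainbow_saturated ?F H c'"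
    "card (edges H) \<le> card (all_pairs {..<k}) + s * n"
    by (rule saturated_graph_exists[OF n])
  then have "card (edges H) \<in> ?M"
    by (intro CollectI exI[of _ H] conjI exI[of _ c']) simp_all
  \<comment> \<open>Existence turns the infimum into a minimum, so the lower bound can be applied to
    an extremal graph.\<close>
  then have "?M \<noteq> {}" "Inf ?M \<le> card (edges H)"
    by (blast, intro cInf_lower) auto
  then have "Inf ?M \<in> ?M" by (intro Inf_nat_def1)
  show "rsat n ?F \<le> card (all_pairs {..<k}) + s * n"
    using H(4) \<open>Inf ?M \<le> card (edges H)\<close> by (simp add: rsat_def)
  have "rsat n ?F \<in> ?M" unfolding rsat_def by fact
  then obtain G' :: "nat graph" and c'' where G': "simple_graph G'" "card (verts G') = n" "rainbow_saturated ?F G' c''"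
    "rsat n ?F = card (edges G')"
    unfolding mem_Collect_eq by blast
  have "s * (card (verts G') - 2 * s) \<le> card (edges G')"
    using G'(1)
  proof (rule edges_lower_bound)
    fix u v assume "u \<in> verts G'" "v \<in> verts G'" "u \<noteq> v" "{u, v} \<notin> edges G'"
    then show "s \<le> card {w. {u, w} \<in> edges G' \<and> {v, w} \<in> edges G'}"
      unfolding s_def using t2 p2 q1 by (intro saturated_common_neighbours[OF G'(3) _ _ G'(1)]) auto
  qed
  then show "s * (n - 2 * s) \<le> rsat n ?F" using G' by simp
qed

end

theorem theorem1p4:
  fixes t p q :: nat
  assumes "t \<ge> 2" and "p \<ge> 2" and "q \<ge> 1"
  shows "\<exists>K::real. \<exists>N::nat. \<forall>n\<ge>N.
    \<bar>real (rsat n (friendship_graph t p q)) - (real p + real q - 1) * real n\<bar> \<le> K"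
proof -
  interpret friendship t p q using assms by unfold_locales
  have s: "real p + real q - 1 = real s" using p2 by (simp add: s_def)
  \<comment> \<open>The first summand is the cost of completing the core below \<open>k\<close>, the
    second the loss of \<open>2 * s\<close> vertices in the lower bound; \<open>k\<close> and
    \<open>s\<close> depend on \<open>t\<close>, \<open>p\<close>, \<open>q\<close> only.\<close>
  let ?K = "real (card (all_pairs {..<k}) + s * (2 * s))"
  have "\<bar>real (rsat n (friendship_graph t p q)) - real s * real n\<bar> \<le> ?K" if n: "n \<ge> k" for n
  proof -
    \<comment> \<open>Only an inequality, because subtraction of naturals is truncated.\<close>
    have "s * n \<le> s * (n - 2 * s + 2 * s)" by (intro mult_le_mono2) simp
    then have "s * n \<le> s * (n - 2 * s) + s * (2 * s)" by (simp only: add_mult_distrib2)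
    then have "s * n \<le> rsat n (friendship_graph t p q) + s * (2 * s)"
      using rsat_bounds(2)[OF n] by linarith
    then have "real (s * n) \<le> real (rsat n (friendship_graph t p q) + s * (2 * s))"
      by (rule of_nat_mono)
    moreover have "rsat n (friendship_graph t p q) \<le> card (all_pairs {..<k}) + s * n + s * (2 * s)"
      using rsat_bounds(1)[OF n] by linarith
    then have "real (rsat n (friendship_graph t p q))
        \<le> real (card (all_pairs {..<k}) + s * n + s * (2 * s))"
      by (rule of_nat_mono)
    ultimately show ?thesis by (simp add: abs_le_iff)
  qed
  then show ?thesis unfolding s by blast
qed

end
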